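(* Let $L>0$ and, for $\lambda>0$, let $u=u^{(\lambda)}$ be the unique mild solution of $\partial_t u_t(x)=\frac12\partial_{xx}u_t(x)+\lambda\sigma(u_t(x))\dot W(t,x)$, $0<x<L$, $t>0$, with Neumann boundary condition $\partial_xu_t(0)=\partial_xu_t(L)=0$ for $t>0$ and initial condition $u_0$. Then the energy $\mathcal{E}_t(\lambda):=\sqrt{\mathrm{E}\|u_t\|^2_{L^2(0,L)}}$ satisfies $$0<\liminf_{t\to\infty}\frac1t\log\mathcal{E}_t(\lambda)<\infty\quad\text{for all }\lambda>0.$$
   Context: $\dot W$ is space-time white noise on $(0,\infty)\times(0,L)$. The function $\sigma:\mathbf{R}\to\mathbf{R}$ is globally Lipschitz and satisfies $l_\sigma|x|\le|\sigma(x)|\le L_\sigma|x|$ for all $x\in\mathbf{R}$, where $l_\sigma,L_\sigma$ are positive constants. The initial condition $u_0:[0,L]\to[0,\infty)$ is a (deterministic) non-negative bounded function with positive support inside $[0,L]$, i.e. $\{u_0>0\}$ has positive Lebesgue measure. Following Walsh, a mild solution is a predictable random field satisfying $$u_t(x)=\int_0^L u_0(y)p_N(t,x,y)\,dy+\lambda\int_0^L\int_0^t p_N(t-s,x,y)\sigma(u_s(y))\,W(ds,dy),$$ where $p_N$ is the heat kernel of $\frac12\partial_{xx}$ on $(0,L)$ with Neumann boundary condition and the stochastic integral is in the sense of Walsh. It is known that there is a unique (up to modification) mild solution with $\sup_{0\le t\le T,\,x}\mathrm{E}|u_t(x)|^2<\infty$ for all $T<\infty$. *)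

theory Defs
  imports "HOL-Probability.Probability"
begin

section \<open>The Neumann heat kernel\<close>

text \<open>
  The functions \<open>neumann_eigenfun L n\<close> are the \<open>L\<^sup>2(0,L)\<close>-normalised eigenfunctions of
  \<open>-(1/2) d\<^sup>2/dx\<^sup>2\<close> on \<open>(0,L)\<close> with Neumann boundary condition and the \<open>neumann_eigenval L n\<close> are
  their eigenvalues.  The heat kernel, i.e. the integral kernel of the semigroup generated by
  \<open>(1/2) d\<^sup>2/dx\<^sup>2\<close> with Neumann boundary condition, is given by its eigenfunction expansion.
  The lemmas below confirm that these are eigenfunctions, that they form a complete orthonormal
  system, and that the kernel acts on them as the semigroup does.
\<close>

definition neumann_eigenfun :: "real \<Rightarrow> nat \<Rightarrow> real \<Rightarrow> real" where
  "neumann_eigenfun L n x =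
     (if n = 0 then sqrt (1 / L) else sqrt (2 / L) * cos (real n * pi * x / L))"

definition neumann_eigenval :: "real \<Rightarrow> nat \<Rightarrow> real" where
  "neumann_eigenval L n = (real n * pi / L)\<^sup>2 / 2"

definition neumann_heat_kernel :: "real \<Rightarrow> real \<Rightarrow> real \<Rightarrow> real \<Rightarrow> real" where
  "neumann_heat_kernel L t x y =
     (\<Sum>n. exp (- neumann_eigenval L n * t) * neumann_eigenfun L n x * neumann_eigenfun L n y)"

lemma neumann_eigenfun_eigen:
  assumes "L > 0"
  obtains e' where
    "\<And>x. (neumann_eigenfun L n has_real_derivative e' x) (at x)"
    "\<And>x. (e' has_real_derivative - 2 * neumann_eigenval L n * neumann_eigenfun L n x) (at x)"
    "e' 0 = 0" "e' L = 0"
proof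
  let ?c = "if n = 0 then 0 else - sqrt (2 / L) * (real n * pi / L)"
  let ?e = "\<lambda>x. ?c * sin (real n * pi * x / L)"
  show "(neumann_eigenfun L n has_real_derivative ?e x) (at x)" for x
    unfolding neumann_eigenfun_def[abs_def]
    using assms by (cases "n = 0") (auto intro!: derivative_eq_intros)
  show "(?e has_real_derivative - 2 * neumann_eigenval L n * neumann_eigenfun L n x) (at x)" for x
    unfolding neumann_eigenfun_def neumann_eigenval_def
    using assms by (cases "n = 0") (auto intro!: derivative_eq_intros simp: power2_eq_square)
  show "?e 0 = 0" "?e L = 0"
    using assms by auto
qed

lemma has_integral_cos_period:
  fixes k :: int and L :: real
  assumes "L > 0"
  shows "((\<lambda>x. cos (of_int k * pi * x / L)) has_integral (if k = 0 then L else 0)) {0..L}"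
proof (cases "k = 0")
  case True
  then show ?thesis
    using has_integral_const_real[of "1::real" 0 L] assms by simp
next
  case False
  let ?F = "\<lambda>x. L / (of_int k * pi) * sin (of_int k * pi * x / L)"
  have "((\<lambda>x. cos (of_int k * pi * x / L)) has_integral (?F L - ?F 0)) {0..L}"
  proof (rule fundamental_theorem_of_calculus)
    fix x
    have "(?F has_real_derivative cos (of_int k * pi * x / L)) (at x within {0..L})"
      using False assms by (auto intro!: derivative_eq_intros)
    then show "(?F has_vector_derivative cos (of_int k * pi * x / L)) (at x within {0..L})"
      by (simp add: has_real_derivative_iff_has_vector_derivative)
  qed (use assms in auto)
  moreover have "sin (of_int k * pi * L / L) = 0"
    using assms sin_zero_iff_int2 by (auto simp del: sin_zero_iff_int2)
  ultimately show ?thesis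
    using False by simp
qed

lemma neumann_eigenfun_orthonormal:
  assumes "L > 0"
  shows "((\<lambda>x. neumann_eigenfun L m x * neumann_eigenfun L n x) has_integral
           (if m = n then 1 else 0)) {0..L}"
proof -
  let ?a = "\<lambda>n::nat. if n = 0 then sqrt (1 / L) else sqrt (2 / L)"
  let ?I = "\<lambda>k::int. if k = 0 then L else 0"
  have e: "neumann_eigenfun L n x = ?a n * cos (real n * pi * x / L)" for n x
    by (simp add: neumann_eigenfun_def)
  have c: "cos (real m * pi * x / L) * cos (real n * pi * x / L) =
      (cos (of_int (int m - int n) * pi * x / L) + cos (of_int (int m + int n) * pi * x / L)) / 2" for x
    by (simp add: cos_times_cos diff_divide_distrib add_divide_distrib left_diff_distrib distrib_right)
  have "((\<lambda>x. ?a m * ?a n *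
      ((cos (of_int (int m - int n) * pi * x / L) + cos (of_int (int m + int n) * pi * x / L)) / 2))
      has_integral (?a m * ?a n * ((?I (int m - int n) + ?I (int m + int n)) / 2))) {0..L}"
    by (intro has_integral_mult_right has_integral_divide has_integral_add has_integral_cos_period assms)
  moreover have "?a m * ?a n * ((?I (int m - int n) + ?I (int m + int n)) / 2) = (if m = n then 1 else 0)"
    using assms by auto
  ultimately show ?thesis
    unfolding e c[symmetric] by (simp add: mult_ac)
qed

lemma neumann_eigenfun_complete:
  assumes L: "L > 0" and f: "continuous_on {0..L} f"
    and orth: "\<And>n. integral {0..L} (\<lambda>x. f x * neumann_eigenfun L n x) = 0"
    and x: "x \<in> {0..L}"
  shows "f x = 0"
proof -
  let ?c = "\<lambda>n x. cos (real n * pi * x / L)"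
  have orth_cos: "integral {0..L} (\<lambda>x. f x * ?c n x) = 0" for n
  proof -
    define a where "a = (if n = 0 then sqrt (1 / L) else sqrt (2 / L))"
    have "a \<noteq> 0" using L by (simp add: a_def)
    have "a * integral {0..L} (\<lambda>x. f x * ?c n x) = integral {0..L} (\<lambda>x. a * (f x * ?c n x))"
      by (rule integral_mult_right[symmetric])
    also have "(\<lambda>x. a * (f x * ?c n x)) = (\<lambda>x. f x * neumann_eigenfun L n x)"
      by (auto simp: neumann_eigenfun_def a_def)
    finally show ?thesis
      using orth[of n] \<open>a \<noteq> 0\<close> by simp
  qed
  have orth_pow: "integral {0..L} (\<lambda>x. f x * (?c 1 x ^ k * ?c n x)) = 0" for k n
  proof (induction k arbitrary: n)
    case 0
    then show ?case using orth_cos by simp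
  next
    case (Suc k)
    define m where "m = (if n = 0 then 1 else n - 1)"
    have c: "?c 1 x * ?c n x = (?c (Suc n) x + ?c m x) / 2" for x
    proof (cases "n = 0")
      case False
      then have "real (Suc n) * pi * x / L = real n * pi * x / L + real 1 * pi * x / L"
        "real m * pi * x / L = real n * pi * x / L - real 1 * pi * x / L"
        by (auto simp: m_def of_nat_diff left_diff_distrib distrib_right diff_divide_distrib add_divide_distrib)
      then show ?thesis
        by (simp only: cos_add cos_diff) simp
    qed (simp add: m_def)
    have i: "(\<lambda>x. f x * (?c 1 x ^ k * ?c n x)) integrable_on {0..L}" for n
      by (intro integrable_continuous_real continuous_intros f) (use L in auto)
    have "f x * (?c 1 x ^ Suc k * ?c n x) =
        (f x * (?c 1 x ^ k * ?c (Suc n) x) + f x * (?c 1 x ^ k * ?c m x)) / 2" for x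
    proof -
      have "f x * (?c 1 x ^ Suc k * ?c n x) = f x * ?c 1 x ^ k * (?c 1 x * ?c n x)"
        by (simp only: power_Suc mult_ac)
      also have "\<dots> = f x * ?c 1 x ^ k * ((?c (Suc n) x + ?c m x) / 2)"
        by (simp only: c)
      finally show ?thesis
        by (simp add: field_simps)
    qed
    moreover have "integral {0..L} (\<lambda>x. (f x * (?c 1 x ^ k * ?c (Suc n) x) + f x * (?c 1 x ^ k * ?c m x)) / 2) = 0"
      using integral_add[OF i[of "Suc n"] i[of m]] Suc.IH[of "Suc n"] Suc.IH[of m]
      by (simp only: integral_divide add_0 div_0)
    ultimately show ?case
      by (simp only:)
  qed
  have orth_poly: "integral {0..L} (\<lambda>x. f x * poly p (?c 1 x)) = 0" for p
  proof -
    have "integral {0..L} (\<lambda>x. f x * poly p (?c 1 x)) =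
        integral {0..L} (\<lambda>x. \<Sum>i\<le>degree p. coeff p i * (f x * (?c 1 x ^ i * ?c 0 x)))"
      by (simp add: poly_altdef sum_distrib_left mult_ac)
    also have "\<dots> = (\<Sum>i\<le>degree p. integral {0..L} (\<lambda>x. coeff p i * (f x * (?c 1 x ^ i * ?c 0 x))))"
      by (rule integral_sum)
        (use L in \<open>auto intro!: integrable_continuous_real continuous_intros f\<close>)
    also have "\<dots> = 0"
      using orth_pow by (intro sum.neutral ballI) (simp only: integral_mult_right mult_zero_right)
    finally show ?thesis .
  qed
  have approx: "\<exists>p. \<forall>x\<in>{0..L}. \<bar>f x - poly p (?c 1 x)\<bar> < e" if "e > 0" for e
  proof -
    have "\<exists>g. (\<exists>p. \<forall>x. g x = poly p (?c 1 x)) \<and> (\<forall>x\<in>{0..L}. \<bar>f x - g x\<bar> < e)"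
    proof (rule Stone_Weierstrass_HOL)
      show "\<exists>p. \<forall>x::real. c = poly p (?c 1 x)" for c
        by (intro exI[of _ "[:c:]"]) simp
      show "continuous_on {0..L} g" if "\<exists>p. \<forall>x. g x = poly p (?c 1 x)" for g
      proof -
        from that obtain p where "g = (\<lambda>x. poly p (?c 1 x))" by auto
        with L show ?thesis by (auto intro!: continuous_intros)
      qed
      show "\<exists>p. \<forall>x. g x + h x = poly p (?c 1 x)"
        if "(\<exists>p. \<forall>x. g x = poly p (?c 1 x)) \<and> (\<exists>p. \<forall>x. h x = poly p (?c 1 x))" for g h
        using that by (metis poly_add)
      show "\<exists>p. \<forall>x. g x * h x = poly p (?c 1 x)"
        if "(\<exists>p. \<forall>x. g x = poly p (?c 1 x)) \<and> (\<exists>p. \<forall>x. h x = poly p (?c 1 x))" for g h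
        using that by (metis poly_mult)
      show "\<exists>g. (\<exists>p. \<forall>x. g x = poly p (?c 1 x)) \<and> g x \<noteq> g y"
        if xy: "x \<in> {0..L} \<and> y \<in> {0..L} \<and> x \<noteq> y" for x y
      proof (intro exI[of _ "?c 1"] conjI exI[of _ "[:0, 1:]"])
        have range: "0 \<le> real 1 * pi * z / L \<and> real 1 * pi * z / L \<le> pi" if "z \<in> {0..L}" for z
        proof -
          have "0 \<le> z / L" "z / L \<le> 1" using that L by auto
          then have "0 \<le> pi * (z / L)" "pi * (z / L) \<le> pi * 1"
            by (intro mult_nonneg_nonneg mult_left_mono; simp)+
          then show ?thesis by simp
        qed
        have "real 1 * pi * x / L = real 1 * pi * y / L" if "?c 1 x = ?c 1 y"
          using range[of x] range[of y] xy that by (blast intro: cos_inj_pi)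
        moreover have "real 1 * pi * x / L \<noteq> real 1 * pi * y / L"
          using xy L by simp
        ultimately show "?c 1 x \<noteq> ?c 1 y"
          by blast
      qed simp
    qed (use f that in auto)
    then obtain g p where "\<forall>x. g x = poly p (?c 1 x)" "\<forall>x\<in>{0..L}. \<bar>f x - g x\<bar> < e"
      by blast
    then show ?thesis
      by (metis (no_types, lifting))
  qed
  have iff2: "(\<lambda>x. f x * f x) integrable_on {0..L}"
    and iff1: "(\<lambda>x. \<bar>f x\<bar>) integrable_on {0..L}"
    by (auto intro!: integrable_continuous_real continuous_intros f)
  define B where "B = integral {0..L} (\<lambda>x. \<bar>f x\<bar>)"
  have B: "0 \<le> B"
    unfolding B_def by (intro integral_nonneg iff1) simp
  have "integral {0..L} (\<lambda>x. f x * f x) \<le> e" if e: "e > 0" for e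
  proof -
    have "e / (B + 1) > 0" using e B by simp
    from approx[OF this] obtain p
      where p: "\<And>x. x \<in> {0..L} \<Longrightarrow> \<bar>f x - poly p (?c 1 x)\<bar> < e / (B + 1)" by blast
    have ip: "(\<lambda>x. f x * poly p (?c 1 x)) integrable_on {0..L}"
      using L by (auto intro!: integrable_continuous_real continuous_intros f)
    have "integral {0..L} (\<lambda>x. f x * f x) =
        integral {0..L} (\<lambda>x. f x * f x) - integral {0..L} (\<lambda>x. f x * poly p (?c 1 x))"
      by (simp only: orth_poly diff_zero)
    also have "\<dots> = integral {0..L} (\<lambda>x. f x * f x - f x * poly p (?c 1 x))"
      by (rule integral_diff[symmetric, OF iff2 ip])
    also have "\<dots> \<le> integral {0..L} (\<lambda>x. e / (B + 1) * \<bar>f x\<bar>)"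
    proof (rule integral_le)
      show "(\<lambda>x. f x * f x - f x * poly p (?c 1 x)) integrable_on {0..L}"
        by (intro integrable_diff iff2 ip)
      show "(\<lambda>x. e / (B + 1) * \<bar>f x\<bar>) integrable_on {0..L}"
        by (intro integrable_continuous_real continuous_intros f)
      fix x assume "x \<in> {0..L}"
      then have "\<bar>f x\<bar> * \<bar>f x - poly p (?c 1 x)\<bar> \<le> \<bar>f x\<bar> * (e / (B + 1))"
        by (intro mult_left_mono less_imp_le[OF p]) auto
      moreover have "f x * f x - f x * poly p (?c 1 x) \<le> \<bar>f x\<bar> * \<bar>f x - poly p (?c 1 x)\<bar>"
        by (metis abs_ge_self abs_mult right_diff_distrib)
      ultimately show "f x * f x - f x * poly p (?c 1 x) \<le> e / (B + 1) * \<bar>f x\<bar>"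
        by (simp add: mult.commute)
    qed
    also have "\<dots> = e / (B + 1) * B"
      by (simp add: B_def)
    also have "\<dots> \<le> e"
      using e B by (simp add: field_simps)
    finally show ?thesis .
  qed
  then have "integral {0..L} (\<lambda>x. f x * f x) \<le> 0"
    by (rule field_le_epsilon) simp
  moreover have "0 \<le> integral {0..L} (\<lambda>x. f x * f x)"
    by (intro integral_nonneg iff2) simp
  ultimately have "integral {0..L} (\<lambda>x. f x * f x) = 0"
    by simp
  then have "\<forall>x\<in>{0..L}. f x * f x = 0"
    using L f by (subst (asm) integral_eq_0_iff) (auto intro!: continuous_intros)
  with x show ?thesis by auto
qed

lemma neumann_heat_kernel_semigroup:
  assumes L: "L > 0" and t: "t > 0"
  shows "((\<lambda>y. neumann_heat_kernel L t x y * neumann_eigenfun L k y) has_integral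
           exp (- neumann_eigenval L k * t) * neumann_eigenfun L k x) {0..L}"
proof -
  let ?e = "neumann_eigenfun L" and ?\<mu> = "neumann_eigenval L"
  define q where "q = exp (- (pi / L)\<^sup>2 / 2 * t)"
  define C where "C = sqrt (1 / L) + sqrt (2 / L)"
  have q: "0 < q" "q < 1"
    using L t by (auto simp: q_def)
  have C: "0 \<le> C" using L by (simp add: C_def)
  have eC: "\<bar>?e n z\<bar> \<le> C" for n z
  proof -
    have "\<bar>sqrt (2 / L) * cos (real n * pi * z / L)\<bar> \<le> sqrt (2 / L) * 1"
      using L by (subst abs_mult, intro mult_mono) auto
    moreover have "0 \<le> sqrt (1 / L)" "0 \<le> sqrt (2 / L)" using L by auto
    ultimately have "\<bar>if n = 0 then sqrt (1 / L) else sqrt (2 / L) * cos (real n * pi * z / L)\<bar>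
        \<le> sqrt (1 / L) + sqrt (2 / L)"
      by (smt (verit))
    then show ?thesis
      unfolding C_def neumann_eigenfun_def .
  qed
  have mu: "exp (- ?\<mu> n * t) \<le> q ^ n" for n
  proof -
    have "real n \<le> (real n)\<^sup>2" by (cases n) (auto simp: power2_eq_square)
    then have "real n * ((pi / L)\<^sup>2 / 2 * t) \<le> (real n)\<^sup>2 * ((pi / L)\<^sup>2 / 2 * t)"
      using t by (intro mult_right_mono) auto
    moreover have "?\<mu> n * t = (real n)\<^sup>2 * ((pi / L)\<^sup>2 / 2 * t)"
      by (simp add: neumann_eigenval_def power_mult_distrib power_divide)
    ultimately have "- ?\<mu> n * t \<le> real n * (- (pi / L)\<^sup>2 / 2 * t)"
      by (simp only: mult_minus_left mult_minus_right minus_divide_left[symmetric] neg_le_iff_le)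
    then show ?thesis
      by (simp only: q_def exp_of_nat_mult[symmetric] exp_le_cancel_iff)
  qed
  let ?S = "\<lambda>N y. \<Sum>n<N. exp (- ?\<mu> n * t) * ?e n x * ?e n y * ?e k y"
  have bnd: "\<bar>exp (- ?\<mu> n * t) * ?e n x * ?e n y * ?e k y\<bar> \<le> q ^ n * C * C * C" for n y
    unfolding abs_mult using mu[of n] eC q C by (intro mult_mono) auto
  have bnd': "\<bar>exp (- ?\<mu> n * t) * ?e n x * ?e n y\<bar> \<le> q ^ n * C * C" for n y
    unfolding abs_mult using mu[of n] eC q C by (intro mult_mono) auto
  have sum_q: "summable (\<lambda>n. q ^ n * C * C * C)" "summable (\<lambda>n. q ^ n * C * C)"
    using q by (auto intro!: summable_mult2 summable_geometric)
  have lim: "uniform_limit {0..L} ?S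
      (\<lambda>y. \<Sum>n. exp (- ?\<mu> n * t) * ?e n x * ?e n y * ?e k y) sequentially"
    using bnd sum_q(1) by (intro Weierstrass_m_test[where M = "\<lambda>n. q ^ n * C * C * C"]) auto
  have eq: "(\<Sum>n. exp (- ?\<mu> n * t) * ?e n x * ?e n y * ?e k y) = neumann_heat_kernel L t x y * ?e k y" for y
    unfolding neumann_heat_kernel_def
    by (rule suminf_mult2[symmetric], rule summable_comparison_test'[OF sum_q(2)])
      (use bnd' in simp)
  have int: "(?S N has_integral (\<Sum>n<N. exp (- ?\<mu> n * t) * ?e n x * (if n = k then 1 else 0))) {0..L}" for N
    unfolding mult.assoc[of _ "?e _ _" "?e k _"]
    by (intro has_integral_sum has_integral_mult_right neumann_eigenfun_orthonormal L) simp
  have cont: "continuous_on {0..L} (?S N)" for N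
  proof -
    have "continuous_on {0..L} (?e n)" for n
      unfolding neumann_eigenfun_def[abs_def] using L
      by (cases "n = 0") (auto intro!: continuous_intros)
    then show ?thesis by (intro continuous_intros)
  qed
  obtain I J where IJ: "\<And>N. (?S N has_integral I N) {0..L}"
    "((\<lambda>y. neumann_heat_kernel L t x y * ?e k y) has_integral J) {0..L}" "I \<longlonglongrightarrow> J"
    using uniform_limit_integral[OF lim[unfolded eq] cont] by auto
  have "(\<lambda>N. integral {0..L} (?S N)) \<longlonglongrightarrow> J"
    using IJ(3) unfolding integral_unique[OF IJ(1)] .
  moreover have "(\<lambda>N. integral {0..L} (?S N)) \<longlonglongrightarrow> exp (- ?\<mu> k * t) * ?e k x"
  proof (rule tendsto_eventually, rule eventually_sequentiallyI[of "Suc k"])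
    fix N assume "Suc k \<le> N"
    then have "(\<Sum>n<N. exp (- ?\<mu> n * t) * ?e n x * (if n = k then 1 else 0)) = exp (- ?\<mu> k * t) * ?e k x"
      by (simp add: if_distrib[of "\<lambda>z. _ * z"] sum.delta cong: if_cong)
    then show "integral {0..L} (?S N) = exp (- ?\<mu> k * t) * ?e k x"
      using int[of N] by (simp add: integral_unique)
  qed
  ultimately have "J = exp (- ?\<mu> k * t) * ?e k x"
    using LIMSEQ_unique by blast
  with IJ(2) show ?thesis
    by simp
qed


section \<open>Space-time white noise\<close>

definition noise_domain :: "real \<Rightarrow> (real \<times> real) set" where
  "noise_domain L = {0<..} \<times> {0<..<L}"

definition centred_gaussian :: "'a measure \<Rightarrow> real \<Rightarrow> ('a \<Rightarrow> real) \<Rightarrow> bool" where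
  "centred_gaussian M v X \<longleftrightarrow>
     X \<in> borel_measurable M \<and>
     (if v = 0 then AE \<omega> in M. X \<omega> = 0
      else 0 < v \<and> distributed M lborel X (normal_density 0 (sqrt v)))"

text \<open>
  White noise on \<open>(0,\<infinity>) \<times> (0,L)\<close> is a centred Gaussian family indexed by the Borel sets of
  finite area, with covariance \<open>E[W A W B] = \<bar>A \<inter> B\<bar>\<close>; its joint law is expressed by the law
  of all finite linear combinations.
\<close>

definition noise_sets :: "real \<Rightarrow> (real \<times> real) set set" where
  "noise_sets L = {A \<in> sets borel. A \<subseteq> noise_domain L \<and> emeasure lborel A < \<infinity>}"

definition white_noise :: "'a measure \<Rightarrow> real \<Rightarrow> ((real \<times> real) set \<Rightarrow> 'a \<Rightarrow> real) \<Rightarrow> bool" where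
  "white_noise M L W \<longleftrightarrow>
     (\<forall>(n::nat) A c. (\<forall>i<n. A i \<in> noise_sets L) \<longrightarrow>
        centred_gaussian M (\<Sum>i<n. \<Sum>j<n. c i * c j * measure lborel (A i \<inter> A j))
          (\<lambda>\<omega>. \<Sum>i<n. c i * W (A i) \<omega>))"

text \<open>
  \<open>F\<close> is any filtration with respect to which \<open>W\<close> is an adapted white noise with increments
  independent of the past.  The filtration generated by \<open>W\<close>, with or without augmentation by
  null sets, is of this kind.  Only the \<open>F t\<close> with \<open>t \<ge> 0\<close> matter; the index set is
  all of \<open>real\<close> only because \<^locale>\<open>filtration\<close> requires this.
\<close>

definition noise_filtration ::
    "'a measure \<Rightarrow> real \<Rightarrow> ((real \<times> real) set \<Rightarrow> 'a \<Rightarrow> real) \<Rightarrow> (real \<Rightarrow> 'a measure) \<Rightarrow> bool" where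
  "noise_filtration M L W F \<longleftrightarrow>
     filtration (space M) F \<and> (\<forall>t. subalgebra M (F t)) \<and>
     (\<forall>t\<ge>0. \<forall>A\<in>noise_sets L. A \<subseteq> {0<..t} \<times> UNIV \<longrightarrow> W A \<in> borel_measurable (F t)) \<and>
     (\<forall>t\<ge>0. prob_space.indep_set M (sets (F t))
        (sigma_sets (space M)
          {W A -` S \<inter> space M | A S. A \<in> noise_sets L \<and> A \<subseteq> {t<..} \<times> UNIV \<and> S \<in> sets borel}))"


section \<open>The stochastic integral of Walsh\<close>

definition predictable_sigma :: "'a measure \<Rightarrow> real \<Rightarrow> (real \<Rightarrow> 'a measure) \<Rightarrow> ((real \<times> real) \<times> 'a) measure" where
  "predictable_sigma M L F =
     sigma (noise_domain L \<times> space M)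
       {({a<..b} \<times> B) \<times> A | a b B A.
          0 \<le> a \<and> a \<le> b \<and> B \<in> sets borel \<and> B \<subseteq> {0<..<L} \<and> A \<in> sets (F a)}"

definition predictable_field ::
    "'a measure \<Rightarrow> real \<Rightarrow> (real \<Rightarrow> 'a measure) \<Rightarrow> (real \<Rightarrow> real \<Rightarrow> 'a \<Rightarrow> real) \<Rightarrow> bool" where
  "predictable_field M L F f \<longleftrightarrow>
     (\<lambda>((s, y), \<omega>). f s y \<omega>) \<in> borel_measurable (predictable_sigma M L F)"

text \<open>
  A list of quadruples \<open>(a, b, B, X)\<close> represents the simple field
  \<open>(s, y, \<omega>) \<mapsto> \<Sum> X(\<omega>) 1\<^bsub>(a,b]\<^esub>(s) 1\<^bsub>B\<^esub>(y)\<close>, with \<open>X\<close> bounded and \<open>F a\<close>-measurable.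
\<close>

type_synonym 'a simple_field = "(real \<times> real \<times> real set \<times> ('a \<Rightarrow> real)) list"

definition simple_field :: "real \<Rightarrow> (real \<Rightarrow> 'a measure) \<Rightarrow> 'a simple_field \<Rightarrow> bool" where
  "simple_field L F h \<longleftrightarrow>
     (\<forall>(a, b, B, X)\<in>set h. 0 \<le> a \<and> a \<le> b \<and> B \<in> sets borel \<and> B \<subseteq> {0<..<L} \<and>
        X \<in> borel_measurable (F a) \<and> bounded (X ` space (F a)))"

definition simple_value :: "'a simple_field \<Rightarrow> real \<Rightarrow> real \<Rightarrow> 'a \<Rightarrow> real" where
  "simple_value h s y \<omega> = (\<Sum>(a, b, B, X)\<leftarrow>h. X \<omega> * indicator ({a<..b} \<times> B) (s, y))"

definition simple_integral :: "((real \<times> real) set \<Rightarrow> 'a \<Rightarrow> real) \<Rightarrow> 'a simple_field \<Rightarrow> 'a \<Rightarrow> real" where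
  "simple_integral W h \<omega> = (\<Sum>(a, b, B, X)\<leftarrow>h. X \<omega> * W ({a<..b} \<times> B) \<omega>)"

text \<open>
  \<open>has_walsh_integral M L W F f I\<close>: the predictable field \<open>f\<close> has stochastic integral \<open>I\<close>
  (unique almost surely) over \<open>(0,\<infinity>) \<times> (0,L)\<close>, as the mean-square limit of the integrals of
  simple fields that converge to \<open>f\<close> in \<open>L\<^sup>2(ds dy dP)\<close>.
\<close>

definition has_walsh_integral ::
    "'a measure \<Rightarrow> real \<Rightarrow> ((real \<times> real) set \<Rightarrow> 'a \<Rightarrow> real) \<Rightarrow> (real \<Rightarrow> 'a measure) \<Rightarrow>
     (real \<Rightarrow> real \<Rightarrow> 'a \<Rightarrow> real) \<Rightarrow> ('a \<Rightarrow> real) \<Rightarrow> bool" where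
  "has_walsh_integral M L W F f I \<longleftrightarrow>
     predictable_field M L F f \<and> I \<in> borel_measurable M \<and>
     (\<exists>h. (\<forall>n::nat. simple_field L F (h n)) \<and>
        (\<lambda>n. \<integral>\<^sup>+\<omega>. (\<integral>\<^sup>+(s, y)\<in>noise_domain L.
           ennreal ((simple_value (h n) s y \<omega> - f s y \<omega>)\<^sup>2) \<partial>lborel) \<partial>M) \<longlonglongrightarrow> 0 \<and>
        (\<lambda>n. \<integral>\<^sup>+\<omega>. ennreal ((simple_integral W (h n) \<omega> - I \<omega>)\<^sup>2) \<partial>M) \<longlonglongrightarrow> 0)"


section \<open>Mild solutions and their energy\<close>

definition mild_solution ::
    "'a measure \<Rightarrow> real \<Rightarrow> ((real \<times> real) set \<Rightarrow> 'a \<Rightarrow> real) \<Rightarrow> (real \<Rightarrow> 'a measure) \<Rightarrow>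
     (real \<Rightarrow> real) \<Rightarrow> (real \<Rightarrow> real) \<Rightarrow> real \<Rightarrow> (real \<Rightarrow> real \<Rightarrow> 'a \<Rightarrow> real) \<Rightarrow> bool" where
  "mild_solution M L W F \<sigma> u\<^sub>0 lam u \<longleftrightarrow>
     predictable_field M L F u \<and>
     (\<forall>x\<in>{0<..<L}. \<forall>\<omega>\<in>space M. u 0 x \<omega> = u\<^sub>0 x) \<and>
     (\<forall>t>0. \<forall>x\<in>{0<..<L}. \<exists>I.
        has_walsh_integral M L W F
          (\<lambda>s y \<omega>. if s < t then neumann_heat_kernel L (t - s) x y * \<sigma> (u s y \<omega>) else 0) I \<and>
        (AE \<omega> in M. u t x \<omega> =
           (LINT y|lebesgue_on {0..L}. u\<^sub>0 y * neumann_heat_kernel L t x y) + lam * I \<omega>)) \<and>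
     (\<forall>T\<ge>0. \<exists>C. \<forall>t\<in>{0..T}. \<forall>x\<in>{0<..<L}. (\<integral>\<^sup>+\<omega>. ennreal ((u t x \<omega>)\<^sup>2) \<partial>M) \<le> ennreal C)"

definition L2_interval_norm :: "real \<Rightarrow> (real \<Rightarrow> real) \<Rightarrow> real" where
  "L2_interval_norm L f = sqrt (LINT x:{0<..<L}|lborel. (f x)\<^sup>2)"

definition energy :: "'a measure \<Rightarrow> real \<Rightarrow> (real \<Rightarrow> real \<Rightarrow> 'a \<Rightarrow> real) \<Rightarrow> real \<Rightarrow> real" where
  "energy M L u t = sqrt (LINT \<omega>|M. (L2_interval_norm L (\<lambda>x. u t x \<omega>))\<^sup>2)"

end

theory Submission
  imports Defs
begin

text \<open>
  Let \<open>G t\<close> be the integral over \<open>(0,L)\<close> of \<open>E[u\<^sub>t(x)\<^sup>2]\<close>, the square of the energy, and let \<open>p\<close> denote the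
  Neumann heat kernel.  The stochastic integral in the mild formulation is centred, and the Walsh
  isometry (\<open>walsh_isometry\<close>) computes its second moment, so that \<open>E[u\<^sub>t(x)\<^sup>2]\<close> is the square of the
  heat flow of \<open>u\<^sub>0\<close> plus \<open>\<lambda>\<^sup>2\<close> times the space-time integral of \<open>p\<^sub>t\<^sub>-\<^sub>s(x,y)\<^sup>2 E[\<sigma>(u\<^sub>s(y))\<^sup>2]\<close>.

  The point is to integrate this over \<open>x\<close> as well (\<open>mean_energy_renewal\<close>).  By Parseval's identity
  (\<open>heat_kernel_parseval\<close>) the integral of \<open>p\<^sub>r(x,y)\<^sup>2\<close> over \<open>x\<close> is
  \<open>\<Sum>\<^sub>n exp (- 2 \<mu>\<^sub>n r) e\<^sub>n(y)\<^sup>2\<close>.  Since \<open>\<mu>\<^sub>0 = 0\<close>, this lies between \<open>1 / L\<close> and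
  \<open>k r = (2 / L) \<Sum>\<^sub>n exp (- 2 \<mu>\<^sub>n r)\<close>, uniformly in \<open>y\<close>.  With the two-sided linear growth of \<open>\<sigma>\<close> the
  function \<open>G\<close> satisfies two scalar Volterra inequalities.

  From below, \<open>G t \<ge> c + \<kappa> \<integral>\<^sub>0\<^sup>t G s ds\<close> with \<open>\<kappa> = \<lambda>\<^sup>2 l\<^sub>\<sigma>\<^sup>2 / L > 0\<close>.  Here \<open>c > 0\<close> because the Neumann
  flow conserves the mass of \<open>u\<^sub>0\<close>, which is positive.  So the lower bound \<open>c\<close> for \<open>G\<close>
  doubles in every period of length \<open>2 / \<kappa>\<close> (\<open>volterra_exponential_lower\<close>).

  From above, \<open>G\<close> is at most a constant plus its convolution with \<open>\<lambda>\<^sup>2 L\<^sub>\<sigma>\<^sup>2 k\<close>.  The Laplace transform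
  of \<open>k\<close> tends to \<open>0\<close> at infinity because \<open>\<Sum>\<^sub>n 1 / \<mu>\<^sub>n\<close>, summed over \<open>n \<ge> 1\<close>, converges
  (\<open>heat_trace_bound_laplace\<close>).  So \<open>G\<close> grows at most exponentially
  (\<open>volterra_exponential_upper\<close>).
\<close>

section \<open>Mean-square convergence\<close>

lemma integrable_square_of_square_diff:
  fixes f g :: "'b \<Rightarrow> real"
  assumes [measurable]: "f \<in> borel_measurable N" "g \<in> borel_measurable N"
    and "integrable N (\<lambda>x. (f x)\<^sup>2)" "integrable N (\<lambda>x. (f x - g x)\<^sup>2)"
  shows "integrable N (\<lambda>x. (g x)\<^sup>2)"
proof (rule Bochner_Integration.integrable_bound)
  show "integrable N (\<lambda>x. 2 * (f x)\<^sup>2 + 2 * (f x - g x)\<^sup>2)"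
    using assms by simp
  have "b\<^sup>2 \<le> 2 * a\<^sup>2 + 2 * (a - b)\<^sup>2" for a b :: real
    using zero_le_power2[of "2 * a - b"] by (simp add: power2_eq_square algebra_simps)
  then show "AE x in N. norm ((g x)\<^sup>2) \<le> norm (2 * (f x)\<^sup>2 + 2 * (f x - g x)\<^sup>2)"
    by auto
qed simp

lemma nn_integral_square_eq_integral:
  fixes f :: "'b \<Rightarrow> real"
  assumes "integrable N (\<lambda>x. (f x)\<^sup>2)"
  shows "(\<integral>\<^sup>+x. ennreal ((f x)\<^sup>2) \<partial>N) = ennreal (\<integral>x. (f x)\<^sup>2 \<partial>N)"
  using assms by (intro nn_integral_eq_integral) auto

lemma integrable_square_iff:
  fixes f :: "'b \<Rightarrow> real"
  assumes [measurable]: "f \<in> borel_measurable N"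
  shows "integrable N (\<lambda>x. (f x)\<^sup>2) \<longleftrightarrow> (\<integral>\<^sup>+x. ennreal ((f x)\<^sup>2) \<partial>N) < \<infinity>"
  by (subst integrable_iff_bounded) auto

text \<open>
  The estimate \<open>\<bar>x\<^sup>2 - y\<^sup>2\<bar> \<le> (1 + 1 / e) (x - y)\<^sup>2 + e y\<^sup>2\<close>, integrated, bounds the difference of the
  squared norms by \<open>(1 + 1 / e)\<close> times a null sequence plus \<open>e\<close> times a constant.  The lemma is
  applied twice to the approximation that defines the Walsh integral: on the probability space,
  and on its product with space-time.
\<close>

lemma L2_tendsto_imp_norm_tendsto:
  fixes g :: "nat \<Rightarrow> 'b \<Rightarrow> real" and f :: "'b \<Rightarrow> real"
  assumes [measurable]: "\<And>n. g n \<in> borel_measurable N" "f \<in> borel_measurable N"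
    and fin: "\<And>n. (\<integral>\<^sup>+x. ennreal ((g n x)\<^sup>2) \<partial>N) < \<infinity>"
    and lim: "(\<lambda>n. \<integral>\<^sup>+x. ennreal ((g n x - f x)\<^sup>2) \<partial>N) \<longlonglongrightarrow> 0"
  shows "(\<integral>\<^sup>+x. ennreal ((f x)\<^sup>2) \<partial>N) < \<infinity>" (is ?fin)
    and "(\<lambda>n. \<integral>\<^sup>+x. ennreal ((g n x)\<^sup>2) \<partial>N) \<longlonglongrightarrow> (\<integral>\<^sup>+x. ennreal ((f x)\<^sup>2) \<partial>N)" (is ?lim)
proof -
  have ig: "integrable N (\<lambda>x. (g n x)\<^sup>2)" for n
    using fin by (subst integrable_square_iff) auto
  from lim have "\<forall>\<^sub>F n in sequentially. (\<integral>\<^sup>+x. ennreal ((g n x - f x)\<^sup>2) \<partial>N) < 1"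
    by (rule order_tendstoD) simp
  then obtain n where "(\<integral>\<^sup>+x. ennreal ((g n x - f x)\<^sup>2) \<partial>N) < 1"
    by (auto simp: eventually_sequentially)
  then have "integrable N (\<lambda>x. (g n x - f x)\<^sup>2)"
    by (subst integrable_square_iff) (auto intro: less_trans)
  from integrable_square_of_square_diff[OF _ _ ig this]
  have "if": "integrable N (\<lambda>x. (f x)\<^sup>2)" by simp
  then show ?fin
    by (subst (asm) integrable_square_iff) auto
  have idiff: "integrable N (\<lambda>x. (g n x - f x)\<^sup>2)" for n
    using integrable_square_of_square_diff[of "\<lambda>x. - f x" N "\<lambda>x. g n x - f x"] "if" ig by simp
  define a where "a = (\<integral>x. (f x)\<^sup>2 \<partial>N)"
  define d where "d n = (\<integral>x. (g n x - f x)\<^sup>2 \<partial>N)" for n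
  have a: "0 \<le> a" and d: "0 \<le> d n" for n
    by (simp_all add: a_def d_def)
  have "(\<lambda>n. ennreal (d n)) \<longlonglongrightarrow> ennreal 0"
    using lim unfolding nn_integral_square_eq_integral[OF idiff] d_def by simp
  then have d0: "d \<longlonglongrightarrow> 0"
    by (subst (asm) tendsto_ennreal_iff) (use d in auto)
  have bound: "\<bar>(\<integral>x. (g n x)\<^sup>2 \<partial>N) - a\<bar> \<le> (1 + 1 / e) * d n + e * a" if e: "e > 0" for e n
  proof -
    have pt: "\<bar>x\<^sup>2 - y\<^sup>2\<bar> \<le> (1 + 1 / e) * (x - y)\<^sup>2 + e * y\<^sup>2" for x y :: real
    proof -
      have "\<bar>x\<^sup>2 - y\<^sup>2\<bar> = \<bar>(x - y)\<^sup>2 + 2 * (x - y) * y\<bar>"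
        by (simp add: power2_eq_square algebra_simps)
      also have "\<dots> \<le> (x - y)\<^sup>2 + \<bar>2 * (x - y) * y\<bar>"
        by (rule order_trans[OF abs_triangle_ineq]) simp
      also have "\<bar>2 * (x - y) * y\<bar> \<le> (x - y)\<^sup>2 / e + e * y\<^sup>2"
      proof -
        have "\<bar>2 * d * y\<bar> \<le> d\<^sup>2 / e + e * y\<^sup>2" for d :: real
        proof -
          have "0 \<le> (\<bar>d\<bar> - e * \<bar>y\<bar>)\<^sup>2 / e" using e by simp
          also have "\<dots> = d\<^sup>2 / e + e * y\<^sup>2 - \<bar>2 * d * y\<bar>"
            using e by (simp add: power2_diff power_mult_distrib abs_mult field_simps) (simp add: power2_eq_square)
          finally show ?thesis by simp
        qed
        then show ?thesis .
      qed
      finally show ?thesis by (simp add: algebra_simps)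
    qed
    have "\<bar>(\<integral>x. (g n x)\<^sup>2 \<partial>N) - a\<bar> = \<bar>\<integral>x. (g n x)\<^sup>2 - (f x)\<^sup>2 \<partial>N\<bar>"
      using ig "if" by (simp add: a_def)
    also have "\<dots> \<le> (\<integral>x. \<bar>(g n x)\<^sup>2 - (f x)\<^sup>2\<bar> \<partial>N)"
      by (rule integral_abs_bound)
    also have "\<dots> \<le> (\<integral>x. (1 + 1 / e) * (g n x - f x)\<^sup>2 + e * (f x)\<^sup>2 \<partial>N)"
      using ig "if" idiff pt by (intro integral_mono) auto
    also have "\<dots> = (1 + 1 / e) * d n + e * a"
      using "if" idiff by (simp add: a_def d_def)
    finally show ?thesis .
  qed
  have "(\<lambda>n. \<integral>x. (g n x)\<^sup>2 \<partial>N) \<longlonglongrightarrow> a"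
  proof (rule tendstoI)
    fix r :: real assume r: "r > 0"
    define e where "e = r / (2 * (a + 1))"
    have e: "e > 0" "e * a \<le> r / 2" using r a by (auto simp: e_def field_simps)
    have "(\<lambda>n. (1 + 1 / e) * d n) \<longlonglongrightarrow> (1 + 1 / e) * 0"
      by (intro tendsto_intros d0)
    then have "\<forall>\<^sub>F n in sequentially. (1 + 1 / e) * d n < r / 2"
      by (rule order_tendstoD) (use r in simp)
    then show "\<forall>\<^sub>F n in sequentially. dist (\<integral>x. (g n x)\<^sup>2 \<partial>N) a < r"
    proof eventually_elim
      case (elim n)
      then show ?case using bound[OF e(1), of n] e(2) unfolding dist_real_def by linarith
    qed
  qed
  then have "(\<lambda>n. ennreal (\<integral>x. (g n x)\<^sup>2 \<partial>N)) \<longlonglongrightarrow> ennreal a"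
    by (rule tendsto_ennrealI)
  then show ?lim
    unfolding nn_integral_square_eq_integral[OF ig] nn_integral_square_eq_integral[OF "if"] a_def .
qed

lemma (in prob_space) centred_gaussian_moments:
  assumes "centred_gaussian M v X"
  shows "integrable M X" "expectation X = 0"
    "integrable M (\<lambda>\<omega>. (X \<omega>)\<^sup>2)" "expectation (\<lambda>\<omega>. (X \<omega>)\<^sup>2) = v"
proof -
  have [measurable]: "X \<in> borel_measurable M"
    using assms by (simp add: centred_gaussian_def)
  have "integrable M X \<and> expectation X = 0 \<and>
    integrable M (\<lambda>\<omega>. (X \<omega>)\<^sup>2) \<and> expectation (\<lambda>\<omega>. (X \<omega>)\<^sup>2) = v"
  proof (cases "v = 0")
    case True
    then have ae: "AE \<omega> in M. X \<omega> = 0" "AE \<omega> in M. (X \<omega>)\<^sup>2 = 0"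
      using assms by (auto simp: centred_gaussian_def)
    have "integrable M X" "integrable M (\<lambda>\<omega>. (X \<omega>)\<^sup>2)"
      using ae by (auto intro!: integrable_cong_AE_imp[of M "\<lambda>_. 0"] elim: eventually_mono)
    moreover have "expectation X = 0" "expectation (\<lambda>\<omega>. (X \<omega>)\<^sup>2) = 0"
      using ae by (auto intro: integral_eq_zero_AE)
    ultimately show ?thesis using True by simp
  next
    case False
    then have v: "0 < v" and D: "distributed M lborel X (normal_density 0 (sqrt v))"
      using assms by (auto simp: centred_gaussian_def)
    have s: "0 < sqrt v" using v by simp
    have "integrable M X"
      by (rule distributed_integrable[OF D, THEN iffD1])
        (use integrable_normal_moment_nz_1[OF s] in simp_all)
    moreover have "integrable M (\<lambda>\<omega>. (X \<omega>)\<^sup>2)"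
      by (rule distributed_integrable[OF D, THEN iffD1])
        (use integrable_normal_moment[of "sqrt v" 0 2] s in simp_all)
    moreover have E: "expectation X = 0"
      by (rule normal_distributed_expectation[OF s D])
    moreover have "expectation (\<lambda>\<omega>. (X \<omega>)\<^sup>2) = v"
      using normal_distributed_variance[OF s D] E v by simp
    ultimately show ?thesis by blast
  qed
  then show "integrable M X" "expectation X = 0"
    "integrable M (\<lambda>\<omega>. (X \<omega>)\<^sup>2)" "expectation (\<lambda>\<omega>. (X \<omega>)\<^sup>2) = v"
    by blast+
qed

lemma integrable_mult_bounded:
  fixes Y Z :: "'b \<Rightarrow> real"
  assumes [measurable]: "Y \<in> borel_measurable N" and Y: "\<And>\<omega>. \<omega> \<in> space N \<Longrightarrow> \<bar>Y \<omega>\<bar> \<le> C"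
    and Z: "integrable N Z"
  shows "integrable N (\<lambda>\<omega>. Y \<omega> * Z \<omega>)"
proof (rule Bochner_Integration.integrable_bound)
  show "integrable N (\<lambda>\<omega>. C * Z \<omega>)" using Z by simp
  have [measurable]: "Z \<in> borel_measurable N" using Z by simp
  show "(\<lambda>\<omega>. Y \<omega> * Z \<omega>) \<in> borel_measurable N" by simp
  have "\<bar>Y \<omega>\<bar> * \<bar>Z \<omega>\<bar> \<le> \<bar>C\<bar> * \<bar>Z \<omega>\<bar>" if "\<omega> \<in> space N" for \<omega>
    using Y[OF that] by (intro mult_right_mono) auto
  then show "AE \<omega> in N. norm (Y \<omega> * Z \<omega>) \<le> norm (C * Z \<omega>)"
    by (auto simp: abs_mult)
qed

lemma integrable_mult_of_squares:
  fixes X Y :: "'b \<Rightarrow> real"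
  assumes [measurable]: "X \<in> borel_measurable N" "Y \<in> borel_measurable N"
    and "integrable N (\<lambda>x. (X x)\<^sup>2)" "integrable N (\<lambda>x. (Y x)\<^sup>2)"
  shows "integrable N (\<lambda>x. X x * Y x)"
proof (rule Bochner_Integration.integrable_bound)
  show "integrable N (\<lambda>x. (X x)\<^sup>2 + (Y x)\<^sup>2)" using assms by simp
  have "\<bar>a * b\<bar> \<le> a\<^sup>2 + b\<^sup>2" for a b :: real
  proof -
    have "0 \<le> \<bar>a * b\<bar>" "0 \<le> (\<bar>a\<bar> - \<bar>b\<bar>)\<^sup>2" by auto
    then show ?thesis unfolding power2_diff abs_mult power2_abs by linarith
  qed
  then show "AE x in N. norm (X x * Y x) \<le> norm ((X x)\<^sup>2 + (Y x)\<^sup>2)"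
    by auto
qed simp

section \<open>The Walsh isometry\<close>

locale walsh_noise = prob_space M for M :: "'a measure" +
  fixes L :: real and W :: "(real \<times> real) set \<Rightarrow> 'a \<Rightarrow> real" and F :: "real \<Rightarrow> 'a measure"
  assumes white: "white_noise M L W" and filt: "noise_filtration M L W F"
begin

lemma noise_gaussian:
  assumes "\<And>i. i < (n::nat) \<Longrightarrow> A i \<in> noise_sets L"
  shows "centred_gaussian M (\<Sum>i<n. \<Sum>j<n. c i * c j * measure lborel (A i \<inter> A j)) (\<lambda>\<omega>. \<Sum>i<n. c i * W (A i) \<omega>)"
  using white assms unfolding white_noise_def by blast

lemma noise_gaussian1:
  assumes "A \<in> noise_sets L"
  shows "centred_gaussian M (measure lborel A) (W A)"
  using noise_gaussian[of 1 "\<lambda>_. A" "\<lambda>_. 1"] assms by simp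

lemma noise_measurable [measurable]: "A \<in> noise_sets L \<Longrightarrow> W A \<in> borel_measurable M"
  using noise_gaussian1[of A] by (simp add: centred_gaussian_def)

lemmas noise_moments = centred_gaussian_moments[OF noise_gaussian1]

lemma noise_mult_integrable:
  assumes "A \<in> noise_sets L" "B \<in> noise_sets L"
  shows "integrable M (\<lambda>\<omega>. W A \<omega> * W B \<omega>)"
  using assms by (intro integrable_mult_of_squares noise_measurable noise_moments)

text \<open>
  Polarisation of the variance of \<open>W A + W B\<close>.
\<close>

lemma noise_covariance:
  assumes A: "A \<in> noise_sets L" and B: "B \<in> noise_sets L"
  shows "expectation (\<lambda>\<omega>. W A \<omega> * W B \<omega>) = measure lborel (A \<inter> B)"
proof -
  let ?A = "\<lambda>i::nat. if i = 0 then A else B"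
  have "centred_gaussian M (measure lborel A + measure lborel B + 2 * measure lborel (A \<inter> B)) (\<lambda>\<omega>. W A \<omega> + W B \<omega>)"
    using noise_gaussian[of 2 ?A "\<lambda>_. 1"] A B by (simp add: numeral_2_eq_2 Int_commute algebra_simps)
  from centred_gaussian_moments(4)[OF this]
  have "measure lborel A + measure lborel B + 2 * measure lborel (A \<inter> B) =
      expectation (\<lambda>\<omega>. (W A \<omega>)\<^sup>2 + (W B \<omega>)\<^sup>2 + 2 * (W A \<omega> * W B \<omega>))"
    by (simp add: power2_sum mult.assoc)
  also have "\<dots> = measure lborel A + measure lborel B + 2 * expectation (\<lambda>\<omega>. W A \<omega> * W B \<omega>)"
    using noise_moments[OF A] noise_moments[OF B] noise_mult_integrable[OF A B] by simp
  finally show ?thesis by simp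
qed

text \<open>
  The law of the linear combination \<open>W (A \<union> B) - W A - W B\<close> is Gaussian, and the covariance
  structure gives it variance zero.
\<close>

lemma noise_additive:
  assumes A: "A \<in> noise_sets L" and B: "B \<in> noise_sets L" and AB: "A \<inter> B = {}"
  shows "AE \<omega> in M. W (A \<union> B) \<omega> = W A \<omega> + W B \<omega>"
proof -
  let ?A = "\<lambda>i::nat. if i = 0 then A \<union> B else if i = 1 then A else B"
  let ?c = "\<lambda>i::nat. if i = 0 then 1 else - 1 :: real"
  have fin: "A \<in> fmeasurable lborel" "B \<in> fmeasurable lborel"
    using A B by (auto simp: noise_sets_def fmeasurable_def)
  have U: "A \<union> B \<in> noise_sets L"
    using fmeasurable.Un[OF fin] A B by (auto simp: noise_sets_def fmeasurable_def)
  have m: "measure lborel (A \<union> B) = measure lborel A + measure lborel B"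
    using measure_Un3[OF fin] AB by simp
  have "(A \<union> B) \<inter> A = A" "(A \<union> B) \<inter> B = B" "B \<inter> (A \<union> B) = B" "A \<inter> (A \<union> B) = A" "B \<inter> A = {}"
    using AB by auto
  then have "centred_gaussian M 0 (\<lambda>\<omega>. W (A \<union> B) \<omega> - W A \<omega> - W B \<omega>)"
    using noise_gaussian[of 3 ?A ?c] A B U m AB by (simp add: numeral_3_eq_3 algebra_simps)
  then show ?thesis
    by (simp add: centred_gaussian_def) (auto elim: eventually_mono)
qed

text \<open>
  The information carried by the noise on strips that begin strictly after time \<open>t\<close>; it is
  independent of \<open>F t\<close>.
\<close>

definition noise_after :: "real \<Rightarrow> 'a measure" where
  "noise_after t = sigma (space M)
     {W A -` S \<inter> space M | A S. A \<in> noise_sets L \<and> A \<subseteq> {t<..} \<times> UNIV \<and> S \<in> sets borel}"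

lemma space_noise_after [simp]: "space (noise_after t) = space M"
  unfolding noise_after_def by (rule space_measure_of) auto

lemma sets_noise_after: "sets (noise_after t) = sigma_sets (space M)
     {W A -` S \<inter> space M | A S. A \<in> noise_sets L \<and> A \<subseteq> {t<..} \<times> UNIV \<and> S \<in> sets borel}"
  unfolding noise_after_def by (rule sets_measure_of) auto

lemma noise_after_measurable:
  assumes "A \<in> noise_sets L" "A \<subseteq> {t<..} \<times> UNIV"
  shows "W A \<in> borel_measurable (noise_after t)"
  by (rule measurableI) (use assms in \<open>auto simp: sets_noise_after\<close>)

lemma space_F: "space (F t) = space M"
  and sets_F_mono: "s \<le> t \<Longrightarrow> sets (F s) \<subseteq> sets (F t)"
  and sets_F_subset: "sets (F t) \<subseteq> sets M"
  using filt filtration.space_F[of "space M" F] filtration.sets_F_mono[of "space M" F]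
  by (auto simp: noise_filtration_def subalgebra_def)

lemma past_measurable_mono:
  assumes "s \<le> t" "X \<in> borel_measurable (F s)" shows "X \<in> borel_measurable (F t)"
  using assms sets_F_mono[OF assms(1)] by (auto simp: measurable_def space_F)

lemma past_measurable: "X \<in> borel_measurable (F t) \<Longrightarrow> X \<in> borel_measurable M"
  using sets_F_subset[of t] by (auto simp: measurable_def space_F)

lemma noise_past_measurable:
  assumes "0 \<le> t" "A \<in> noise_sets L" "A \<subseteq> {0<..t} \<times> UNIV"
  shows "W A \<in> borel_measurable (F t)"
  using filt assms by (auto simp: noise_filtration_def)

lemma past_future_indep:
  fixes Y Z :: "'a \<Rightarrow> real"
  assumes t: "0 \<le> t" and Y: "Y \<in> borel_measurable (F t)" "integrable M Y"
    and Z: "Z \<in> borel_measurable (noise_after t)" "integrable M Z"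
  shows "integrable M (\<lambda>\<omega>. Y \<omega> * Z \<omega>)"
    and "expectation (\<lambda>\<omega>. Y \<omega> * Z \<omega>) = expectation Y * expectation Z"
proof -
  have ind: "indep_set (sets (F t)) (sets (noise_after t))"
    using filt t by (auto simp: noise_filtration_def sets_noise_after)
  have sub: "sigma_sets (space M) {V -` S \<inter> space M |S. S \<in> sets borel} \<subseteq> sets N"
    if "V \<in> borel_measurable N" "space N = space M" for V :: "'a \<Rightarrow> real" and N
  proof -
    have "V -` S \<inter> space M \<in> sets N" if "S \<in> sets borel" for S
      using measurable_sets[OF \<open>V \<in> borel_measurable N\<close> that] \<open>space N = space M\<close> by simp
    then have "sigma_sets (space N) {V -` S \<inter> space M |S. S \<in> sets borel} \<subseteq> sets N"
      by (intro sets.sigma_sets_subset) auto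
    then show ?thesis using \<open>space N = space M\<close> by simp
  qed
  have "indep_var borel Y borel Z"
    unfolding indep_var_eq
  proof (intro conjI)
    show "random_variable borel Y" "random_variable borel Z"
      using Y Z by auto
    show "indep_set (sigma_sets (space M) {Y -` A \<inter> space M |A. A \<in> sets borel})
       (sigma_sets (space M) {Z -` A \<inter> space M |A. A \<in> sets borel})"
      using ind sub[OF Y(1) space_F] sub[OF Z(1) space_noise_after]
      unfolding indep_sets2_eq by (meson subset_iff)
  qed
  then show "integrable M (\<lambda>\<omega>. Y \<omega> * Z \<omega>)" "expectation (\<lambda>\<omega>. Y \<omega> * Z \<omega>) = expectation Y * expectation Z"
    using indep_var_integrable indep_var_lebesgue_integral Y Z by auto
qed

lemma rectangle_noise_set:
  assumes "0 \<le> a" "B \<in> sets borel" "B \<subseteq> {0<..<L}"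
  shows "{a<..b} \<times> B \<in> noise_sets L"
proof -
  have "bounded ({a<..b} \<times> B)"
    using assms(3) by (intro bounded_Times) (auto intro: bounded_subset[of "{0<..<L}"])
  moreover have "{a<..b} \<times> B \<in> sets borel"
    using assms(2) by (intro borel_Times) auto
  ultimately show ?thesis
    using emeasure_bounded_finite assms by (auto simp: noise_sets_def noise_domain_def)
qed

abbreviation simple_term :: "real \<Rightarrow> real \<Rightarrow> real set \<Rightarrow> ('a \<Rightarrow> real) \<Rightarrow> bool" where
  "simple_term a b B X \<equiv> simple_field L F [(a, b, B, X)]"

lemma simple_termD:
  assumes "simple_term a b B X"
  shows "0 \<le> a" "{a<..b} \<times> B \<in> noise_sets L" "X \<in> borel_measurable (F a)" "X \<in> borel_measurable M"
    "\<exists>C. \<forall>\<omega>\<in>space M. \<bar>X \<omega>\<bar> \<le> C"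
proof -
  have *: "0 \<le> a" "B \<in> sets borel" "B \<subseteq> {0<..<L}" "X \<in> borel_measurable (F a)" "bounded (X ` space M)"
    using assms by (simp_all add: simple_field_def space_F)
  show "0 \<le> a" "X \<in> borel_measurable (F a)" by fact+
  show "{a<..b} \<times> B \<in> noise_sets L" by (rule rectangle_noise_set[OF *(1-3)])
  show "X \<in> borel_measurable M" by (rule past_measurable[OF *(4)])
  show "\<exists>C. \<forall>\<omega>\<in>space M. \<bar>X \<omega>\<bar> \<le> C"
    using *(5) by (simp add: bounded_iff)
qed

lemma simple_term_expectation:
  assumes "simple_term a b B X"
  shows "integrable M (\<lambda>\<omega>. X \<omega> * W ({a<..b} \<times> B) \<omega>)"
    and "expectation (\<lambda>\<omega>. X \<omega> * W ({a<..b} \<times> B) \<omega>) = 0"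
proof -
  note D = simple_termD[OF assms]
  from D(5) obtain C where C: "\<And>\<omega>. \<omega> \<in> space M \<Longrightarrow> \<bar>X \<omega>\<bar> \<le> C" by auto
  have X: "integrable M X"
    using D(4) C by (intro integrable_const_bound[of _ C]) auto
  have Z: "W ({a<..b} \<times> B) \<in> borel_measurable (noise_after a)"
    by (rule noise_after_measurable[OF D(2)]) auto
  show "integrable M (\<lambda>\<omega>. X \<omega> * W ({a<..b} \<times> B) \<omega>)"
    "expectation (\<lambda>\<omega>. X \<omega> * W ({a<..b} \<times> B) \<omega>) = 0"
    using past_future_indep[OF D(1,3) X Z] noise_moments[OF D(2)] by auto
qed

text \<open>
  The orthogonality behind the isometry.  Say \<open>a \<le> a'\<close>, and cut the rectangle \<open>R\<close> at time \<open>a'\<close>.  The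
  early part of \<open>W R\<close> belongs to the past of \<open>a'\<close>, so it is independent of the centred \<open>W R'\<close> and
  contributes nothing.  The late part, multiplied by \<open>W R'\<close>, belongs to the future of \<open>a'\<close>, so the
  bounded weight \<open>X X'\<close> factors out and the noise covariance remains.  The product is symmetric in
  the two terms, which covers the other case.
\<close>

lemma simple_term_covariance:
  assumes S: "simple_term a b B X" and S': "simple_term a' b' B' X'"
  defines "R \<equiv> {a<..b} \<times> B" and "R' \<equiv> {a'<..b'} \<times> B'"
  shows "integrable M (\<lambda>\<omega>. (X \<omega> * W R \<omega>) * (X' \<omega> * W R' \<omega>)) \<and>
    expectation (\<lambda>\<omega>. (X \<omega> * W R \<omega>) * (X' \<omega> * W R' \<omega>)) =
      expectation (\<lambda>\<omega>. X \<omega> * X' \<omega>) * measure lborel (R \<inter> R')"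
proof -
  have main: "integrable M (\<lambda>\<omega>. (X \<omega> * W R \<omega>) * (X' \<omega> * W R' \<omega>)) \<and>
    expectation (\<lambda>\<omega>. (X \<omega> * W R \<omega>) * (X' \<omega> * W R' \<omega>)) =
      expectation (\<lambda>\<omega>. X \<omega> * X' \<omega>) * measure lborel (R \<inter> R')"
    if S: "simple_term a b B X" and S': "simple_term a' b' B' X'" and le: "a \<le> a'"
      and R: "R = {a<..b} \<times> B" and R': "R' = {a'<..b'} \<times> B'"
    for a b B X a' b' B' X' R R'
  proof -
    note D = simple_termD[OF S] and D' = simple_termD[OF S']
    from D(5) obtain C where C: "\<And>\<omega>. \<omega> \<in> space M \<Longrightarrow> \<bar>X \<omega>\<bar> \<le> C" by auto
    from D'(5) obtain C' where C': "\<And>\<omega>. \<omega> \<in> space M \<Longrightarrow> \<bar>X' \<omega>\<bar> \<le> C'" by auto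
    \<comment> \<open>the parts of \<open>R\<close> before and after time \<open>a'\<close>\<close>
    define Rm where "Rm = {a<..min b a'} \<times> B"
    define Rp where "Rp = {a'<..b} \<times> B"
    have B: "B \<in> sets borel" "B \<subseteq> {0<..<L}"
      using S by (auto simp: simple_field_def)
    have N: "Rm \<in> noise_sets L" "Rp \<in> noise_sets L" "R \<in> noise_sets L" "R' \<in> noise_sets L"
      using D(1) D'(1) D(2) D'(2) B R R' by (auto simp: Rm_def Rp_def intro!: rectangle_noise_set)
    have disj: "Rm \<inter> Rp = {}" and un: "Rm \<union> Rp = R"
      using le by (auto simp: Rm_def Rp_def R)
    have add: "AE \<omega> in M. W R \<omega> = W Rm \<omega> + W Rp \<omega>"
      using noise_additive[OF N(1,2) disj] un by simp
    let ?Y = "\<lambda>\<omega>. X \<omega> * X' \<omega>"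
    have Y [measurable]: "?Y \<in> borel_measurable (F a')"
      using past_measurable_mono[OF le D(3)] D'(3) by simp
    have CY: "\<bar>?Y \<omega>\<bar> \<le> \<bar>C\<bar> * \<bar>C'\<bar>" if "\<omega> \<in> space M" for \<omega>
      unfolding abs_mult using C[OF that] C'[OF that] by (intro mult_mono) auto
    have Yi: "integrable M ?Y"
      using past_measurable[OF Y] CY by (intro integrable_const_bound[of _ "\<bar>C\<bar> * \<bar>C'\<bar>"]) auto
    have "Rm \<subseteq> {0<..a'} \<times> UNIV"
      using D(1) by (auto simp: Rm_def)
    from noise_past_measurable[OF D'(1) N(1) this]
    have YWF: "(\<lambda>\<omega>. ?Y \<omega> * W Rm \<omega>) \<in> borel_measurable (F a')"
      using Y by simp
    have YWi: "integrable M (\<lambda>\<omega>. ?Y \<omega> * W Rm \<omega>)"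
      using integrable_mult_bounded[OF past_measurable[OF Y] CY noise_moments(1)[OF N(1)]] by simp
    have WR': "W R' \<in> borel_measurable (noise_after a')" and WRp: "W Rp \<in> borel_measurable (noise_after a')"
      by (rule noise_after_measurable; use N in \<open>auto simp: R' Rp_def\<close>)+
    note 1 = past_future_indep[OF D'(1) YWF YWi WR' noise_moments(1)[OF N(4)]]
    have "(\<lambda>\<omega>. W Rp \<omega> * W R' \<omega>) \<in> borel_measurable (noise_after a')"
      using WR' WRp by simp
    note 2 = past_future_indep[OF D'(1) Y Yi this noise_mult_integrable[OF N(2,4)]]
    have "R \<inter> R' = Rp \<inter> R'"
      using le by (auto simp: R R' Rp_def)
    then have e2: "expectation (\<lambda>\<omega>. ?Y \<omega> * (W Rp \<omega> * W R' \<omega>)) = expectation ?Y * measure lborel (R \<inter> R')"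
      using 2(2) noise_covariance[OF N(2,4)] by simp
    have e1: "expectation (\<lambda>\<omega>. ?Y \<omega> * W Rm \<omega> * W R' \<omega>) = 0"
      using 1(2) noise_moments(2)[OF N(4)] by simp
    let ?T = "\<lambda>\<omega>. ?Y \<omega> * W Rm \<omega> * W R' \<omega> + ?Y \<omega> * (W Rp \<omega> * W R' \<omega>)"
    have ae: "AE \<omega> in M. (X \<omega> * W R \<omega>) * (X' \<omega> * W R' \<omega>) = ?T \<omega>"
      using add by eventually_elim (simp add: algebra_simps)
    have meas: "(\<lambda>\<omega>. (X \<omega> * W R \<omega>) * (X' \<omega> * W R' \<omega>)) \<in> borel_measurable M" "?T \<in> borel_measurable M"
      using D(4) D'(4) N by auto
    have "integrable M (\<lambda>\<omega>. (X \<omega> * W R \<omega>) * (X' \<omega> * W R' \<omega>)) \<longleftrightarrow> integrable M ?T"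
      using meas ae by (intro integrable_cong_AE) auto
    moreover have "expectation (\<lambda>\<omega>. (X \<omega> * W R \<omega>) * (X' \<omega> * W R' \<omega>)) = expectation ?T"
      using meas ae by (intro integral_cong_AE) auto
    moreover have "integrable M ?T" using 1 2 by auto
    moreover have "expectation ?T = expectation ?Y * measure lborel (R \<inter> R')"
      using 1 2 e1 e2 by simp
    ultimately show ?thesis by simp
  qed
  show ?thesis
  proof (cases "a \<le> a'")
    case True
    then show ?thesis using main[OF S S' True] by (simp add: R_def R'_def)
  next
    case False
    then have "a' \<le> a" by simp
    from main[OF S' S this refl refl] show ?thesis
      by (simp add: R_def R'_def mult.commute Int_commute)
  qed
qed

text \<open>
  Both squared norms expand into the same double sum over pairs of terms, with the entry
  \<open>E[X\<^sub>i X\<^sub>j] \<bar>R\<^sub>i \<inter> R\<^sub>j\<bar>\<close>.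
\<close>

lemma simple_integral_isometry:
  assumes h: "simple_field L F h"
  shows "integrable M (simple_integral W h)" and "expectation (simple_integral W h) = 0"
    and "(\<integral>\<^sup>+\<omega>. ennreal ((simple_integral W h \<omega>)\<^sup>2) \<partial>M) < \<infinity>"
    and "(\<integral>\<^sup>+\<omega>. (\<integral>\<^sup>+(s, y)\<in>noise_domain L. ennreal ((simple_value h s y \<omega>)\<^sup>2) \<partial>lborel) \<partial>M) =
      (\<integral>\<^sup>+\<omega>. ennreal ((simple_integral W h \<omega>)\<^sup>2) \<partial>M)"
proof -
  define n where "n = length h"
  define a where "a i = fst (h ! i)" for i
  define b where "b i = fst (snd (h ! i))" for i
  define B where "B i = fst (snd (snd (h ! i)))" for i
  define X where "X i = snd (snd (snd (h ! i)))" for i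
  define R where "R i = {a i<..b i} \<times> B i" for i
  have S: "simple_term (a i) (b i) (B i) (X i)" if "i < n" for i
  proof -
    have "(a i, b i, B i, X i) \<in> set h"
      using that by (simp add: a_def b_def B_def X_def n_def)
    then show ?thesis using h by (auto simp: simple_field_def)
  qed
  note D = simple_termD[OF S, folded R_def]
  have SI: "simple_integral W h \<omega> = (\<Sum>i<n. X i \<omega> * W (R i) \<omega>)" for \<omega>
    by (simp add: simple_integral_def sum_list_sum_nth n_def R_def X_def a_def b_def B_def
        case_prod_beta atLeast0LessThan)
  have SV: "simple_value h s y \<omega> = (\<Sum>i<n. X i \<omega> * indicator (R i) (s, y))" for s y \<omega>
    by (simp add: simple_value_def sum_list_sum_nth n_def R_def X_def a_def b_def B_def
        case_prod_beta atLeast0LessThan)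
  show "integrable M (simple_integral W h)" "expectation (simple_integral W h) = 0"
    unfolding SI[abs_def] using simple_term_expectation[OF S, folded R_def] by auto
  define m where "m i j = measure lborel (R i \<inter> R j)" for i j
  let ?Q = "\<lambda>\<omega>. \<Sum>i<n. \<Sum>j<n. X i \<omega> * X j \<omega> * m i j"
  note cov = simple_term_covariance[OF S S, folded R_def, folded m_def]
  have sq: "(\<Sum>i<n. f i)\<^sup>2 = (\<Sum>i<n. \<Sum>j<n. f i * f j)" for f :: "nat \<Rightarrow> real"
    by (simp add: power2_eq_square sum_product)
  have XX: "integrable M (\<lambda>\<omega>. X i \<omega> * X j \<omega>)" if ij: "i < n" "j < n" for i j
  proof -
    from D(5)[OF ij(1)] obtain C where C: "\<And>\<omega>. \<omega> \<in> space M \<Longrightarrow> \<bar>X i \<omega>\<bar> \<le> C" by auto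
    from D(5)[OF ij(2)] obtain C' where C': "\<And>\<omega>. \<omega> \<in> space M \<Longrightarrow> \<bar>X j \<omega>\<bar> \<le> C'" by auto
    have "integrable M (X j)"
      using D(4)[OF ij(2)] C' by (intro integrable_const_bound[of _ C']) auto
    from integrable_mult_bounded[OF D(4)[OF ij(1)] C this] show ?thesis by simp
  qed
  have intI: "integrable M (\<lambda>\<omega>. (simple_integral W h \<omega>)\<^sup>2)"
    unfolding SI sq using cov by (intro Bochner_Integration.integrable_sum) auto
  have EI: "expectation (\<lambda>\<omega>. (simple_integral W h \<omega>)\<^sup>2) = (\<Sum>i<n. \<Sum>j<n. expectation (\<lambda>\<omega>. X i \<omega> * X j \<omega>) * m i j)"
  proof -
    have "expectation (\<lambda>\<omega>. (simple_integral W h \<omega>)\<^sup>2) =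
        (\<Sum>i<n. \<Sum>j<n. expectation (\<lambda>\<omega>. (X i \<omega> * W (R i) \<omega>) * (X j \<omega> * W (R j) \<omega>)))"
      unfolding SI sq using cov
      by (subst Bochner_Integration.integral_sum, force)
        (intro sum.cong Bochner_Integration.integral_sum; force)
    also have "\<dots> = (\<Sum>i<n. \<Sum>j<n. expectation (\<lambda>\<omega>. X i \<omega> * X j \<omega>) * m i j)"
      using cov by (intro sum.cong) auto
    finally show ?thesis .
  qed
  have intQ: "integrable M ?Q"
    using XX by (intro Bochner_Integration.integrable_sum integrable_mult_left) auto
  have EQ: "expectation ?Q = (\<Sum>i<n. \<Sum>j<n. expectation (\<lambda>\<omega>. X i \<omega> * X j \<omega>) * m i j)"
    using XX by (subst Bochner_Integration.integral_sum, force)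
        (intro sum.cong refl; subst Bochner_Integration.integral_sum; force)
  have Rfin: "R i \<in> sets lborel" "R i \<subseteq> noise_domain L" "emeasure lborel (R i) < \<infinity>" if "i < n" for i
    using D(2)[OF that] by (auto simp: noise_sets_def)
  have Rint: "integrable lborel (indicat_real (R i \<inter> R j))" if "i < n" "j < n" for i j
    using Rfin[of i] Rfin[of j] that
    by (intro integrable_real_indicator) (auto intro: le_less_trans[OF emeasure_mono])
  have sqR: "(\<Sum>i<n. X i \<omega> * indicator (R i) z)\<^sup>2 =
      (\<Sum>i<n. \<Sum>j<n. X i \<omega> * X j \<omega> * indicator (R i \<inter> R j) z)" for z \<omega>
    unfolding sq indicator_inter_arith by (simp only: mult_ac)
  have nonneg: "0 \<le> (\<Sum>i<n. \<Sum>j<n. X i \<omega> * X j \<omega> * indicator (R i \<inter> R j) z)" for z \<omega>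
    unfolding sqR[symmetric] by simp
  have Q: "(\<integral>z. (\<Sum>i<n. \<Sum>j<n. X i \<omega> * X j \<omega> * indicator (R i \<inter> R j) z) \<partial>lborel) = ?Q \<omega>" for \<omega>
  proof -
    have "(\<integral>z. (\<Sum>i<n. \<Sum>j<n. X i \<omega> * X j \<omega> * indicator (R i \<inter> R j) z) \<partial>lborel) =
        (\<Sum>i<n. \<Sum>j<n. \<integral>z. X i \<omega> * X j \<omega> * indicator (R i \<inter> R j) z \<partial>lborel)"
      using Rint
      by (subst Bochner_Integration.integral_sum,
          intro Bochner_Integration.integrable_sum integrable_mult_right, blast)
        (intro sum.cong refl Bochner_Integration.integral_sum integrable_mult_right; blast)
    then show ?thesis by (simp add: m_def)
  qed
  have Qpos: "0 \<le> ?Q \<omega>" for \<omega>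
    unfolding Q[symmetric] by (rule Bochner_Integration.integral_nonneg) (rule nonneg)
  have inner: "(\<integral>\<^sup>+(s, y)\<in>noise_domain L. ennreal ((simple_value h s y \<omega>)\<^sup>2) \<partial>lborel) = ennreal (?Q \<omega>)" for \<omega>
  proof -
    have "(\<integral>\<^sup>+(s, y)\<in>noise_domain L. ennreal ((simple_value h s y \<omega>)\<^sup>2) \<partial>lborel) =
        (\<integral>\<^sup>+z. ennreal (\<Sum>i<n. \<Sum>j<n. X i \<omega> * X j \<omega> * indicator (R i \<inter> R j) z) \<partial>lborel)"
    proof (intro nn_integral_cong)
      fix z :: "real \<times> real"
      show "(case z of (s, y) \<Rightarrow> ennreal ((simple_value h s y \<omega>)\<^sup>2)) * indicator (noise_domain L) z =
        ennreal (\<Sum>i<n. \<Sum>j<n. X i \<omega> * X j \<omega> * indicator (R i \<inter> R j) z)"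
      proof (cases "z \<in> noise_domain L")
        case True
        then show ?thesis
          by (cases z) (simp only: SV sqR indicator_simps prod.case mult_1_right)
      next
        case False
        then have "indicat_real (R i \<inter> R j) z = 0" if "i < n" for i j
          using Rfin(2)[OF that(1)] by (auto simp: indicator_def)
        then have "(\<Sum>i<n. \<Sum>j<n. X i \<omega> * X j \<omega> * indicator (R i \<inter> R j) z) = 0"
          by (intro sum.neutral ballI) auto
        with False show ?thesis by (simp add: indicator_def)
      qed
    qed
    also have "\<dots> = ennreal (\<integral>z. (\<Sum>i<n. \<Sum>j<n. X i \<omega> * X j \<omega> * indicator (R i \<inter> R j) z) \<partial>lborel)"
      using Rint nonneg by (intro nn_integral_eq_integral Bochner_Integration.integrable_sum integrable_mult_right) auto
    also note Q
    finally show ?thesis .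
  qed
  show "(\<integral>\<^sup>+\<omega>. ennreal ((simple_integral W h \<omega>)\<^sup>2) \<partial>M) < \<infinity>"
    unfolding nn_integral_square_eq_integral[OF intI] by simp
  show "(\<integral>\<^sup>+\<omega>. (\<integral>\<^sup>+(s, y)\<in>noise_domain L. ennreal ((simple_value h s y \<omega>)\<^sup>2) \<partial>lborel) \<partial>M) =
      (\<integral>\<^sup>+\<omega>. ennreal ((simple_integral W h \<omega>)\<^sup>2) \<partial>M)"
    unfolding inner nn_integral_square_eq_integral[OF intI] EI EQ[symmetric]
    using Qpos by (intro nn_integral_eq_integral intQ) simp
qed

text \<open>
  Every generating rectangle of the predictable \<open>\<sigma>\<close>-algebra is measurable for the product
  \<open>\<sigma>\<close>-algebra.  Joint measurability is what allows expectations and space-time integrals to be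
  exchanged, and it makes every time slice of a predictable field jointly measurable.
\<close>

lemma predictable_field_measurable:
  assumes "predictable_field M L F f"
  shows "(\<lambda>(z, \<omega>). f (fst z) (snd z) \<omega> * indicator (noise_domain L) z) \<in> borel_measurable (borel \<Otimes>\<^sub>M M)"
proof -
  let ?N = "borel \<Otimes>\<^sub>M M :: ((real \<times> real) \<times> 'a) measure"
  let ?D = "noise_domain L \<times> space M"
  have D: "?D \<in> sets ?N"
    unfolding noise_domain_def by (intro pair_measureI borel_Times) auto
  have "(\<lambda>x. x) \<in> measurable (restrict_space ?N ?D) (predictable_sigma M L F)"
    unfolding predictable_sigma_def
  proof (rule measurable_measure_of)
    show "{({a<..b} \<times> B) \<times> A |a b B A. 0 \<le> a \<and> a \<le> b \<and> B \<in> sets borel \<and> B \<subseteq> {0<..<L} \<and> A \<in> sets (F a)} \<subseteq> Pow ?D"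
    proof
      fix Y assume "Y \<in> {({a<..b} \<times> B) \<times> A |a b B A. 0 \<le> a \<and> a \<le> b \<and> B \<in> sets borel \<and> B \<subseteq> {0<..<L} \<and> A \<in> sets (F a)}"
      then obtain a b B A where Y: "Y = ({a<..b} \<times> B) \<times> A" "0 \<le> a" "B \<subseteq> {0<..<L}" and "A \<in> sets (F a)" by auto
      moreover have "A \<subseteq> space M"
        using sets.sets_into_space[OF \<open>A \<in> sets (F a)\<close>] by (simp add: space_F)
      ultimately show "Y \<in> Pow ?D" by (auto simp: noise_domain_def)
    qed
    show "(\<lambda>x. x) \<in> space (restrict_space ?N ?D) \<rightarrow> ?D"
      by (auto simp: space_restrict_space)
    fix Y assume "Y \<in> {({a<..b} \<times> B) \<times> A |a b B A. 0 \<le> a \<and> a \<le> b \<and> B \<in> sets borel \<and> B \<subseteq> {0<..<L} \<and> A \<in> sets (F a)}"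
    then obtain a b B A where Y: "Y = ({a<..b} \<times> B) \<times> A" and "B \<in> sets borel" "A \<in> sets (F a)" by auto
    have "A \<in> sets M"
      using sets_F_subset \<open>A \<in> sets (F a)\<close> by blast
    then have "Y \<in> sets ?N"
      unfolding Y using \<open>B \<in> sets borel\<close> by (intro pair_measureI borel_Times) simp_all
    then have "?D \<inter> Y \<in> sets (restrict_space ?N ?D)"
      unfolding sets_restrict_space by (rule imageI)
    moreover have "(\<lambda>x. x) -` Y \<inter> space (restrict_space ?N ?D) = ?D \<inter> Y"
      using sets.sets_into_space[OF D] by (auto simp only: space_restrict_space vimage_ident)
    ultimately show "(\<lambda>x. x) -` Y \<inter> space (restrict_space ?N ?D) \<in> sets (restrict_space ?N ?D)"
      by (simp only:)
  qed
  from measurable_comp[OF this assms[unfolded predictable_field_def]]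
  have "(\<lambda>x. indicator ?D x *\<^sub>R (case x of (z, \<omega>) \<Rightarrow> f (fst z) (snd z) \<omega>)) \<in> borel_measurable ?N"
    by (subst borel_measurable_restrict_space_iff[symmetric]) (use D in \<open>auto simp: comp_def case_prod_beta\<close>)
  then show ?thesis
    by (rule measurable_cong[THEN iffD1, rotated]) (auto simp: space_pair_measure indicator_times)
qed

lemma simple_value_measurable:
  assumes "simple_field L F h"
  shows "(\<lambda>(z, \<omega>). simple_value h (fst z) (snd z) \<omega>) \<in> borel_measurable (borel \<Otimes>\<^sub>M M)"
  using assms
proof (induction h)
  case Nil
  then show ?case by (simp add: simple_value_def)
next
  case (Cons t h)
  obtain a b B X where t: "t = (a, b, B, X)" by (cases t)
  have "simple_field L F h" "simple_term a b B X"
    using Cons.prems by (auto simp: simple_field_def t)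
  note D = simple_termD[OF this(2)]
  have R [measurable]: "{a<..b} \<times> B \<in> sets borel"
    using D(2) by (simp add: noise_sets_def)
  note D(4) [measurable]
  note Cons.IH[OF \<open>simple_field L F h\<close>, measurable]
  have "(\<lambda>x. X (snd x) * indicator ({a<..b} \<times> B) (fst x) + (case x of (z, \<omega>) \<Rightarrow> simple_value h (fst z) (snd z) \<omega>))
      \<in> borel_measurable (borel \<Otimes>\<^sub>M M)"
    by measurable
  then show ?case
    by (simp add: simple_value_def t case_prod_beta)
qed

text \<open>
  The isometry passes from simple fields to the limit because squared norms are continuous under
  mean-square convergence, on both sides; the mean is controlled by
  \<open>(E I)\<^sup>2 \<le> E (simple_integral W (h n) - I)\<^sup>2\<close>.
\<close>

theorem walsh_isometry:
  assumes I: "has_walsh_integral M L W F f I"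
  shows "integrable M I" and "expectation I = 0" and "integrable M (\<lambda>\<omega>. (I \<omega>)\<^sup>2)"
    and "ennreal (expectation (\<lambda>\<omega>. (I \<omega>)\<^sup>2)) =
      (\<integral>\<^sup>+\<omega>. (\<integral>\<^sup>+z. ennreal ((f (fst z) (snd z) \<omega> * indicator (noise_domain L) z)\<^sup>2) \<partial>lborel) \<partial>M)"
proof -
  let ?D = "noise_domain L"
  let ?N = "M \<Otimes>\<^sub>M (lborel :: (real \<times> real) measure)"
  have pf: "predictable_field M L F f" and Im [measurable]: "I \<in> borel_measurable M"
    using I by (auto simp: has_walsh_integral_def)
  from I obtain h where h: "\<And>n::nat. simple_field L F (h n)"
    and lim1: "(\<lambda>n. \<integral>\<^sup>+\<omega>. (\<integral>\<^sup>+(s, y)\<in>?D. ennreal ((simple_value (h n) s y \<omega> - f s y \<omega>)\<^sup>2) \<partial>lborel) \<partial>M) \<longlonglongrightarrow> 0"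
    and lim2: "(\<lambda>n. \<integral>\<^sup>+\<omega>. ennreal ((simple_integral W (h n) \<omega> - I \<omega>)\<^sup>2) \<partial>M) \<longlonglongrightarrow> 0"
    by (auto simp: has_walsh_integral_def)
  note iso = simple_integral_isometry[OF h]
  have SIm [measurable]: "simple_integral W (h n) \<in> borel_measurable M" for n
    using iso(1) by (rule borel_measurable_integrable)
  note L2 = L2_tendsto_imp_norm_tendsto[OF SIm Im iso(3) lim2]
  then show I2: "integrable M (\<lambda>\<omega>. (I \<omega>)\<^sup>2)"
    by (subst integrable_square_iff) auto
  then show I1: "integrable M I"
    by (rule square_integrable_imp_integrable[OF Im])
  define g where "g n = (\<lambda>(\<omega>, z). simple_value (h n) (fst z) (snd z) \<omega> * indicator ?D z)" for n
  define k where "k = (\<lambda>(\<omega>, z). f (fst z) (snd z) \<omega> * indicator ?D z)"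
  have D [measurable]: "?D \<in> sets borel"
    unfolding noise_domain_def by (intro borel_Times) auto
  have swap: "(\<lambda>(\<omega>, z). (z, \<omega>)) \<in> measurable ?N (borel \<Otimes>\<^sub>M M)"
    by measurable
  have km [measurable]: "k \<in> borel_measurable ?N"
    using measurable_comp[OF swap predictable_field_measurable[OF pf]]
    by (simp add: k_def comp_def case_prod_beta)
  have gm [measurable]: "g n \<in> borel_measurable ?N" for n
    using measurable_comp[OF swap simple_value_measurable[OF h[of n]]]
    by (simp add: g_def comp_def case_prod_beta)
  have fst: "(\<integral>\<^sup>+\<omega>. (\<integral>\<^sup>+z. ennreal ((\<phi> (\<omega>, z))\<^sup>2) \<partial>lborel) \<partial>M) = (\<integral>\<^sup>+x. ennreal ((\<phi> x)\<^sup>2) \<partial>?N)"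
    if [measurable]: "\<phi> \<in> borel_measurable ?N" for \<phi>
    by (rule lborel.nn_integral_fst) simp
  have restr: "(\<integral>\<^sup>+(s, y)\<in>?D. ennreal ((\<phi> s y)\<^sup>2) \<partial>lborel) =
      (\<integral>\<^sup>+z. ennreal ((\<phi> (fst z) (snd z) * indicator ?D z)\<^sup>2) \<partial>lborel)" for \<phi>
    by (intro nn_integral_cong) (auto simp: indicator_def)
  have gn: "(\<integral>\<^sup>+x. ennreal ((g n x)\<^sup>2) \<partial>?N) = (\<integral>\<^sup>+\<omega>. ennreal ((simple_integral W (h n) \<omega>)\<^sup>2) \<partial>M)" for n
    unfolding iso(4)[symmetric] restr fst[OF gm, symmetric] by (simp add: g_def)
  have "(\<integral>\<^sup>+x. ennreal ((g n x - k x)\<^sup>2) \<partial>?N) =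
     (\<integral>\<^sup>+\<omega>. (\<integral>\<^sup>+(s, y)\<in>?D. ennreal ((simple_value (h n) s y \<omega> - f s y \<omega>)\<^sup>2) \<partial>lborel) \<partial>M)" for n
    unfolding restr by (subst fst[symmetric], measurable) (simp add: g_def k_def left_diff_distrib)
  with lim1 have lim3: "(\<lambda>n. \<integral>\<^sup>+x. ennreal ((g n x - k x)\<^sup>2) \<partial>?N) \<longlonglongrightarrow> 0" by simp
  have "(\<lambda>n. \<integral>\<^sup>+x. ennreal ((g n x)\<^sup>2) \<partial>?N) \<longlonglongrightarrow> (\<integral>\<^sup>+x. ennreal ((k x)\<^sup>2) \<partial>?N)"
    by (rule L2_tendsto_imp_norm_tendsto(2)[OF gm km _ lim3]) (use iso(3) gn in simp)
  with L2(2) have "(\<integral>\<^sup>+\<omega>. ennreal ((I \<omega>)\<^sup>2) \<partial>M) = (\<integral>\<^sup>+x. ennreal ((k x)\<^sup>2) \<partial>?N)"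
    unfolding gn by (rule LIMSEQ_unique)
  then show "ennreal (expectation (\<lambda>\<omega>. (I \<omega>)\<^sup>2)) =
      (\<integral>\<^sup>+\<omega>. (\<integral>\<^sup>+z. ennreal ((f (fst z) (snd z) \<omega> * indicator ?D z)\<^sup>2) \<partial>lborel) \<partial>M)"
    unfolding nn_integral_square_eq_integral[OF I2] fst[OF km, symmetric] by (simp add: k_def)
  show "expectation I = 0"
  proof -
    have bnd: "ennreal ((expectation I)\<^sup>2) \<le> (\<integral>\<^sup>+\<omega>. ennreal ((simple_integral W (h n) \<omega> - I \<omega>)\<^sup>2) \<partial>M)" for n
    proof -
      let ?d = "\<lambda>\<omega>. simple_integral W (h n) \<omega> - I \<omega>"
      have "integrable M (\<lambda>\<omega>. (simple_integral W (h n) \<omega>)\<^sup>2)"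
        using iso(3) by (subst integrable_square_iff) auto
      from integrable_square_of_square_diff[of "\<lambda>\<omega>. - I \<omega>" M ?d] this I2
      have d2: "integrable M (\<lambda>\<omega>. (?d \<omega>)\<^sup>2)" by simp
      have d1: "integrable M ?d" using iso(1) I1 by simp
      have "expectation ?d = - expectation I" using iso(1,2) I1 by simp
      then have "variance ?d = expectation (\<lambda>\<omega>. (?d \<omega>)\<^sup>2) - (expectation I)\<^sup>2"
        using variance_eq[OF d1 d2] by simp
      moreover have "0 \<le> variance ?d" by (rule variance_positive)
      ultimately have "(expectation I)\<^sup>2 \<le> expectation (\<lambda>\<omega>. (?d \<omega>)\<^sup>2)"
        by linarith
      then show ?thesis
        unfolding nn_integral_square_eq_integral[OF d2] by (rule ennreal_leI)
    qed
    have "ennreal ((expectation I)\<^sup>2) \<le> 0"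
      by (rule LIMSEQ_le_const[OF lim2]) (use bnd in auto)
    then show ?thesis by simp
  qed
qed

end

section \<open>Bounds on the Neumann heat kernel\<close>

lemma neumann_eigenval_nonneg [simp]: "0 \<le> neumann_eigenval L n"
  by (simp add: neumann_eigenval_def)

lemma neumann_eigenval_0 [simp]: "neumann_eigenval L 0 = 0"
  by (simp add: neumann_eigenval_def)

lemma neumann_eigenfun_bound:
  assumes "L > 0" shows "\<bar>neumann_eigenfun L n x\<bar> \<le> sqrt (2 / L)"
proof (cases "n = 0")
  case True
  then show ?thesis using assms by (simp add: neumann_eigenfun_def divide_right_mono)
next
  case False
  have "sqrt (2 / L) * \<bar>cos (real n * pi * x / L)\<bar> \<le> sqrt (2 / L) * 1"
    using assms by (intro mult_left_mono) auto
  then show ?thesis using False assms by (simp add: neumann_eigenfun_def abs_mult)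
qed

lemma neumann_eigenfun_mult_bound:
  assumes "L > 0" shows "\<bar>neumann_eigenfun L n x * neumann_eigenfun L m y\<bar> \<le> 2 / L"
proof -
  have "\<bar>neumann_eigenfun L n x\<bar> * \<bar>neumann_eigenfun L m y\<bar> \<le> sqrt (2 / L) * sqrt (2 / L)"
    using assms by (intro mult_mono neumann_eigenfun_bound) auto
  then show ?thesis using assms by (simp add: abs_mult)
qed

lemma neumann_eigenfun_measurable [measurable]: "neumann_eigenfun L n \<in> borel_measurable borel"
  unfolding neumann_eigenfun_def[abs_def] by measurable

lemma summable_exp_eigenval:
  assumes "L > 0" "t > 0" shows "summable (\<lambda>n. exp (- neumann_eigenval L n * t))"
proof (rule summable_comparison_test')
  define q where "q = exp (- (pi / L)\<^sup>2 / 2 * t)"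
  have "0 < q" "q < 1" using assms by (auto simp: q_def)
  then show "summable (\<lambda>n. q ^ n)" by (simp add: summable_geometric)
  show "norm (exp (- neumann_eigenval L n * t)) \<le> q ^ n" for n
  proof -
    have "real n \<le> (real n)\<^sup>2" by (cases n) (auto simp: power2_eq_square)
    then have "real n * ((pi / L)\<^sup>2 / 2 * t) \<le> (real n)\<^sup>2 * ((pi / L)\<^sup>2 / 2 * t)"
      using assms by (intro mult_right_mono) auto
    moreover have "neumann_eigenval L n * t = (real n)\<^sup>2 * ((pi / L)\<^sup>2 / 2 * t)"
      by (simp add: neumann_eigenval_def power_mult_distrib power_divide)
    ultimately have "- neumann_eigenval L n * t \<le> real n * (- (pi / L)\<^sup>2 / 2 * t)"
      by (simp only: mult_minus_left mult_minus_right minus_divide_left[symmetric] neg_le_iff_le)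
    then show ?thesis
      by (simp only: q_def exp_of_nat_mult[symmetric] exp_le_cancel_iff norm_exp real_norm_def abs_exp_cancel)
  qed
qed

lemma neumann_heat_kernel_measurable [measurable (raw)]:
  assumes [measurable]: "f \<in> borel_measurable N" "g \<in> borel_measurable N" "h \<in> borel_measurable N"
  shows "(\<lambda>w. neumann_heat_kernel L (f w) (g w) (h w)) \<in> borel_measurable N"
  unfolding neumann_heat_kernel_def by measurable

lemma neumann_heat_kernel_commute: "neumann_heat_kernel L t x y = neumann_heat_kernel L t y x"
  unfolding neumann_heat_kernel_def by (simp add: mult_ac)

lemma neumann_heat_kernel_term_bound:
  assumes "L > 0"
  shows "\<bar>exp (- neumann_eigenval L n * t) * neumann_eigenfun L n x * neumann_eigenfun L n y\<bar>
    \<le> exp (- neumann_eigenval L n * t) * (2 / L)"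
proof -
  have "\<bar>exp (- neumann_eigenval L n * t) * (neumann_eigenfun L n x * neumann_eigenfun L n y)\<bar>
      = exp (- neumann_eigenval L n * t) * \<bar>neumann_eigenfun L n x * neumann_eigenfun L n y\<bar>"
    by (simp add: abs_mult)
  also have "\<dots> \<le> exp (- neumann_eigenval L n * t) * (2 / L)"
    by (intro mult_left_mono neumann_eigenfun_mult_bound assms) simp
  finally show ?thesis by (simp add: mult.assoc)
qed

text \<open>
  The eigenfunctions are bounded and their weights decrease in time, so the series at time \<open>t\<close>
  dominates all later ones.
\<close>

lemma neumann_heat_kernel_bounded_after:
  assumes "L > 0" "t > 0"
  obtains C where "\<And>s x y. s \<ge> t \<Longrightarrow> \<bar>neumann_heat_kernel L s x y\<bar> \<le> C"
proof
  fix s x y :: real assume s: "s \<ge> t"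
  let ?a = "\<lambda>n. exp (- neumann_eigenval L n * s) * neumann_eigenfun L n x * neumann_eigenfun L n y"
  have sm: "summable (\<lambda>n. exp (- neumann_eigenval L n * t) * (2 / L))"
    using assms by (intro summable_mult2 summable_exp_eigenval)
  have b: "\<bar>?a n\<bar> \<le> exp (- neumann_eigenval L n * t) * (2 / L)" for n
  proof -
    have "exp (- neumann_eigenval L n * s) * (2 / L) \<le> exp (- neumann_eigenval L n * t) * (2 / L)"
      using s assms by (intro mult_right_mono) (auto intro: mult_left_mono)
    with neumann_heat_kernel_term_bound[OF assms(1)] show ?thesis by (rule order_trans)
  qed
  have sa: "summable (\<lambda>n. \<bar>?a n\<bar>)"
    by (rule summable_comparison_test'[OF sm]) (simp only: real_norm_def abs_idempotent b)
  have "\<bar>\<Sum>n. ?a n\<bar> \<le> (\<Sum>n. \<bar>?a n\<bar>)"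
    by (rule summable_rabs[OF sa])
  also have "\<dots> \<le> (\<Sum>n. exp (- neumann_eigenval L n * t) * (2 / L))"
    by (rule suminf_le[OF b sa sm])
  finally show "\<bar>neumann_heat_kernel L s x y\<bar> \<le> (\<Sum>n. exp (- neumann_eigenval L n * t) * (2 / L))"
    unfolding neumann_heat_kernel_def .
qed

lemma neumann_heat_kernel_bounded:
  assumes "L > 0" "t > 0"
  obtains C where "\<And>x y. \<bar>neumann_heat_kernel L t x y\<bar> \<le> C"
  using neumann_heat_kernel_bounded_after[OF assms] by (metis order_refl)

lemma set_integral_neumann_heat_kernel_eigenfun:
  assumes "L > 0" "t > 0"
  shows "(LINT x:{0<..<L}|lborel. neumann_heat_kernel L t x y * neumann_eigenfun L k x) =
      exp (- neumann_eigenval L k * t) * neumann_eigenfun L k y" 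
    and "set_integrable lborel {0<..<L} (\<lambda>x. neumann_heat_kernel L t x y * neumann_eigenfun L k x)"
proof -
  let ?f = "\<lambda>x. neumann_heat_kernel L t x y * neumann_eigenfun L k x"
  obtain C where C: "\<And>x y. \<bar>neumann_heat_kernel L t x y\<bar> \<le> C"
    using neumann_heat_kernel_bounded[OF assms] by blast
  have bnd: "\<bar>?f x\<bar> \<le> C * sqrt (2 / L)" for x
    unfolding abs_mult using C neumann_eigenfun_bound[OF assms(1)]
    by (intro mult_mono) (auto intro: order_trans[OF abs_ge_zero])
  have int: "set_integrable lborel S ?f" if "S \<in> {{0<..<L}, {0..L}}" for S
    unfolding set_integrable_def
    by (rule integrableI_bounded_set[of S _ _ "C * sqrt (2 / L)"])
      (use that bnd assms in \<open>auto simp: indicator_def\<close>)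
  show "set_integrable lborel {0<..<L} ?f" using int by simp
  have "(?f has_integral exp (- neumann_eigenval L k * t) * neumann_eigenfun L k y) {0..L}"
    using neumann_heat_kernel_semigroup[OF assms, of y k] by (simp add: neumann_heat_kernel_commute)
  then have "exp (- neumann_eigenval L k * t) * neumann_eigenfun L k y = (LINT x:{0..L}|lborel. ?f x)"
    using set_borel_integral_eq_integral(2)[OF int[of "{0..L}"]] by (simp add: integral_unique)
  also have "\<dots> = (LINT x:{0<..<L}|lborel. ?f x)"
  proof (unfold set_lebesgue_integral_def, rule integral_cong_AE)
    have "AE x in lborel. x \<noteq> 0 \<and> x \<noteq> L"
      using AE_lborel_singleton[of 0] AE_lborel_singleton[of L] by eventually_elim simp
    then show "AE x in lborel. indicator {0..L} x *\<^sub>R ?f x = indicator {0<..<L} x *\<^sub>R ?f x"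
      by eventually_elim (auto simp: indicator_def)
  qed simp_all
  finally show "(LINT x:{0<..<L}|lborel. ?f x) = exp (- neumann_eigenval L k * t) * neumann_eigenfun L k y" ..
qed

text \<open>
  The constant eigenfunction belongs to the eigenvalue \<open>0\<close>: the Neumann flow conserves mass.
\<close>

lemma neumann_heat_kernel_mass:
  assumes "L > 0" "t > 0"
  shows "(LINT x:{0<..<L}|lborel. neumann_heat_kernel L t x y) = 1"
  using set_integral_neumann_heat_kernel_eigenfun(1)[OF assms, of y 0] assms
  by (simp add: neumann_eigenfun_def)

definition heat_kernel_energy :: "real \<Rightarrow> real \<Rightarrow> real \<Rightarrow> ennreal" where
  "heat_kernel_energy L t y = (\<integral>\<^sup>+x\<in>{0<..<L}. ennreal ((neumann_heat_kernel L t x y)\<^sup>2) \<partial>lborel)"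

text \<open>
  Parseval's identity, that is \<open>heat_kernel_energy L t y\<close> is the diagonal value of the kernel at time
  \<open>2 t\<close>.  Expanding one of the two factors of \<open>p\<^sup>2\<close> in eigenfunctions and integrating term by term,
  the other factor only enters through its action on eigenfunctions.
\<close>

lemma heat_kernel_parseval:
  assumes "L > 0" "t > 0"
  shows "summable (\<lambda>n. exp (- 2 * neumann_eigenval L n * t) * (neumann_eigenfun L n y)\<^sup>2)"
    and "heat_kernel_energy L t y =
      ennreal (\<Sum>n. exp (- 2 * neumann_eigenval L n * t) * (neumann_eigenfun L n y)\<^sup>2)"
proof -
  let ?p = "\<lambda>x. neumann_heat_kernel L t x y" and ?e = "neumann_eigenfun L" and ?\<mu> = "neumann_eigenval L"
  obtain C where C: "\<And>x y. \<bar>neumann_heat_kernel L t x y\<bar> \<le> C"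
    using neumann_heat_kernel_bounded[OF assms] by blast
  have C0: "0 \<le> C" using C[of 0 0] by linarith
  define f where "f n x = (exp (- ?\<mu> n * t) * ?e n y) * (indicator {0<..<L} x *\<^sub>R (?p x * ?e n x))" for n x
  note eig = set_integral_neumann_heat_kernel_eigenfun[OF assms, unfolded set_integrable_def set_lebesgue_integral_def]
  have fi: "integrable lborel (f n)" for n
    unfolding f_def by (intro integrable_mult_right eig)
  have fI: "(\<integral>x. f n x \<partial>lborel) = exp (- 2 * ?\<mu> n * t) * (?e n y)\<^sup>2" for n
  proof -
    have "(\<integral>x. f n x \<partial>lborel) = (exp (- ?\<mu> n * t) * ?e n y) * (exp (- ?\<mu> n * t) * ?e n y)"
      unfolding f_def by (simp only: integral_mult_right_zero eig)
    also have "\<dots> = (exp (- ?\<mu> n * t) * exp (- ?\<mu> n * t)) * (?e n y)\<^sup>2"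
      by (simp add: power2_eq_square)
    finally show ?thesis by (simp add: mult_exp_exp)
  qed
  have f_bound: "\<bar>f n x\<bar> \<le> exp (- ?\<mu> n * t) * (2 / L * C) * indicator {0<..<L} x" for n x
  proof -
    have "\<bar>exp (- ?\<mu> n * t) * ?e n y * ?e n x\<bar> * \<bar>?p x\<bar> \<le> (exp (- ?\<mu> n * t) * (2 / L)) * C"
      using assms C0 by (intro mult_mono neumann_heat_kernel_term_bound C) auto
    then show ?thesis by (auto simp: f_def abs_mult indicator_def mult_ac)
  qed
  have sums_term: "summable (\<lambda>n. exp (- ?\<mu> n * t) * c)" for c
    using assms by (intro summable_mult2 summable_exp_eigenval)
  have sm1: "summable (\<lambda>n. \<bar>f n x\<bar>)" for x
    by (rule summable_comparison_test'[OF sums_term[of "2 / L * C * indicator {0<..<L} x"]])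
      (use f_bound in \<open>simp add: mult.assoc\<close>)
  have sm2: "summable (\<lambda>n. \<integral>x. \<bar>f n x\<bar> \<partial>lborel)"
  proof (rule summable_comparison_test'[OF sums_term[of "2 / L * C * L"]])
    fix n :: nat
    have "(\<integral>x. \<bar>f n x\<bar> \<partial>lborel) \<le> (\<integral>x. exp (- ?\<mu> n * t) * (2 / L * C) * indicator {0<..<L} x \<partial>lborel)"
      using fi f_bound assms
      by (intro integral_mono integrable_mult_right integrable_real_indicator integrable_abs) auto
    then show "norm (\<integral>x. \<bar>f n x\<bar> \<partial>lborel) \<le> exp (- ?\<mu> n * t) * (2 / L * C * L)"
      using assms by (simp add: mult.assoc)
  qed
  have sumf: "(\<Sum>n. f n x) = indicator {0<..<L} x * (?p x)\<^sup>2" for x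
  proof -
    have "summable (\<lambda>n. exp (- ?\<mu> n * t) * ?e n x * ?e n y)"
      by (rule summable_comparison_test'[OF sums_term[of "2 / L"]])
        (use neumann_heat_kernel_term_bound[OF assms(1)] in simp)
    then have "(\<Sum>n. exp (- ?\<mu> n * t) * ?e n x * ?e n y * (indicator {0<..<L} x * ?p x)) =
        ?p x * (indicator {0<..<L} x * ?p x)"
      unfolding neumann_heat_kernel_def by (rule suminf_mult2[symmetric])
    then show ?thesis
      by (simp add: f_def mult_ac power2_eq_square)
  qed
  have ae: "AE x in lborel. summable (\<lambda>n. norm (f n x))" and sm2': "summable (\<lambda>n. \<integral>x. norm (f n x) \<partial>lborel)"
    using sm1 sm2 by simp_all
  note S = integrable_suminf[OF fi ae sm2'] sums_integral[OF fi ae sm2']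
  show "summable (\<lambda>n. exp (- 2 * ?\<mu> n * t) * (?e n y)\<^sup>2)"
    using S(2) unfolding fI by (rule sums_summable)
  have "heat_kernel_energy L t y = (\<integral>\<^sup>+x. ennreal (\<Sum>n. f n x) \<partial>lborel)"
    unfolding heat_kernel_energy_def sumf by (intro nn_integral_cong) (auto simp: indicator_def)
  also have "\<dots> = ennreal (\<integral>x. (\<Sum>n. f n x) \<partial>lborel)"
    by (rule nn_integral_eq_integral[OF S(1)]) (simp add: sumf)
  also have "(\<integral>x. (\<Sum>n. f n x) \<partial>lborel) = (\<Sum>n. exp (- 2 * ?\<mu> n * t) * (?e n y)\<^sup>2)"
    using S(2) unfolding fI by (rule sums_unique)
  finally show "heat_kernel_energy L t y = ennreal (\<Sum>n. exp (- 2 * ?\<mu> n * t) * (?e n y)\<^sup>2)" .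
qed

text \<open>
  The Parseval series with each \<open>(neumann_eigenfun L n y)\<^sup>2\<close> replaced by its bound \<open>2 / L\<close>.  Values in
  the extended reals make integration term by term unconditional; the series diverges at time \<open>0\<close>.
\<close>

definition heat_trace_bound :: "real \<Rightarrow> real \<Rightarrow> ennreal" where
  "heat_trace_bound L t = (\<Sum>n. ennreal (2 / L * exp (- 2 * neumann_eigenval L n * t)))"

lemma heat_trace_bound_measurable [measurable]: "heat_trace_bound L \<in> borel_measurable borel"
  unfolding heat_trace_bound_def[abs_def] by measurable

text \<open>
  The lower bound is the term of the constant eigenfunction.  It does not decay in time, and this
  is what makes the energy grow for every \<open>\<lambda> > 0\<close>.
\<close>

lemma heat_kernel_energy_lower:
  assumes "L > 0" "t > 0" shows "ennreal (1 / L) \<le> heat_kernel_energy L t y"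
proof -
  have "1 / L = (\<Sum>n\<in>{0}. exp (- 2 * neumann_eigenval L n * t) * (neumann_eigenfun L n y)\<^sup>2)"
    using assms by (simp add: neumann_eigenfun_def power2_eq_square)
  also have "\<dots> \<le> (\<Sum>n. exp (- 2 * neumann_eigenval L n * t) * (neumann_eigenfun L n y)\<^sup>2)"
    by (rule sum_le_suminf[OF heat_kernel_parseval(1)[OF assms]]) auto
  finally show ?thesis
    unfolding heat_kernel_parseval(2)[OF assms] by (rule ennreal_leI)
qed

lemma heat_kernel_energy_upper:
  assumes "L > 0" "t > 0" shows "heat_kernel_energy L t y \<le> heat_trace_bound L t"
proof -
  have sq: "(neumann_eigenfun L n y)\<^sup>2 \<le> 2 / L" for n
    using neumann_eigenfun_mult_bound[OF assms(1), of n y n y] by (simp add: power2_eq_square)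
  have "heat_kernel_energy L t y = (\<Sum>n. ennreal (exp (- 2 * neumann_eigenval L n * t) * (neumann_eigenfun L n y)\<^sup>2))"
    unfolding heat_kernel_parseval(2)[OF assms] using heat_kernel_parseval(1)[OF assms]
    by (intro suminf_ennreal2[symmetric]) auto
  also have "\<dots> \<le> heat_trace_bound L t"
    unfolding heat_trace_bound_def
    unfolding mult.commute[of "2 / L"]
    by (intro suminf_le ennreal_leI mult_left_mono sq) simp_all
  finally show ?thesis .
qed

text \<open>
  The Laplace transform at \<open>\<beta>\<close> is at most \<open>(2 / L) \<Sum>\<^sub>n 1 / (\<beta> + 2 \<mu>\<^sub>n)\<close>, where the eigenvalues \<open>\<mu>\<^sub>n\<close> grow
  quadratically.  The tail of this series is small uniformly in \<open>\<beta>\<close>, and the remaining finitely many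
  terms are at most \<open>1 / \<beta>\<close> each.  Hence the singularity of the kernel at time \<open>0\<close> is harmless.
\<close>

lemma heat_trace_bound_laplace:
  assumes "L > 0" "e > 0"
  obtains \<beta> where "\<beta> > 0"
    "(\<integral>\<^sup>+t\<in>{0<..}. ennreal (exp (- \<beta> * t)) * heat_trace_bound L t \<partial>lborel) \<le> ennreal e"
proof -
  let ?\<mu> = "neumann_eigenval L"
  have Laplace: "(\<integral>\<^sup>+t\<in>{0<..}. ennreal (exp (- \<beta> * t)) * heat_trace_bound L t \<partial>lborel)
      \<le> (\<Sum>n. ennreal (2 / L * (1 / (\<beta> + 2 * ?\<mu> n))))" if \<beta>: "\<beta> > 0" for \<beta>
  proof -
    have "(\<integral>\<^sup>+t\<in>{0<..}. ennreal (exp (- \<beta> * t)) * heat_trace_bound L t \<partial>lborel)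
      = (\<integral>\<^sup>+t. (\<Sum>n. ennreal (2 / L * exp (- (\<beta> + 2 * ?\<mu> n) * t)) * indicator {0<..} t) \<partial>lborel)"
    proof (intro nn_integral_cong)
      fix t :: real
      have *: "ennreal (exp (- \<beta> * t)) * ennreal (2 / L * exp (- 2 * ?\<mu> n * t)) = ennreal (2 / L * exp (- (\<beta> + 2 * ?\<mu> n) * t))" for n
        using assms by (simp add: ennreal_mult[symmetric] exp_add[symmetric] algebra_simps)
      show "ennreal (exp (- \<beta> * t)) * heat_trace_bound L t * indicator {0<..} t =
        (\<Sum>n. ennreal (2 / L * exp (- (\<beta> + 2 * ?\<mu> n) * t)) * indicator {0<..} t)"
        unfolding heat_trace_bound_def ennreal_suminf_cmult[symmetric] ennreal_suminf_multc * ..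
    qed
    also have "\<dots> = (\<Sum>n. \<integral>\<^sup>+t. ennreal (2 / L * exp (- (\<beta> + 2 * ?\<mu> n) * t)) * indicator {0<..} t \<partial>lborel)"
      by (rule nn_integral_suminf) simp
    also have "\<dots> \<le> (\<Sum>n. ennreal (2 / L * (1 / (\<beta> + 2 * ?\<mu> n))))"
    proof (intro suminf_le allI)
      fix n
      define c where "c = \<beta> + 2 * ?\<mu> n"
      have c: "c > 0" using \<beta> by (simp add: c_def add_pos_nonneg)
      have "(\<integral>\<^sup>+t. ennreal (2 / L * exp (- c * t)) * indicator {0<..} t \<partial>lborel) \<le>
          (\<integral>\<^sup>+t. ennreal (2 / L * exp (- c * t)) * indicator {0..} t \<partial>lborel)"
        by (intro nn_integral_mono) (auto simp: indicator_def)
      also have "\<dots> = ennreal (0 - (- (2 / (L * c)) * exp (- c * 0)))"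
      proof (rule nn_integral_FTC_atLeast)
        show "((\<lambda>t. - (2 / (L * c)) * exp (- c * t)) has_real_derivative 2 / L * exp (- c * t)) (at t)" for t
          using c assms by (auto intro!: derivative_eq_intros)
        have "((\<lambda>t. exp (- c * t)) \<longlongrightarrow> 0) at_top"
          using c by (intro filterlim_compose[OF exp_at_bot]
            filterlim_tendsto_neg_mult_at_bot[OF tendsto_const _ filterlim_ident]) auto
        from tendsto_mult[OF tendsto_const this, of "- (2 / (L * c))"]
        show "((\<lambda>t. - (2 / (L * c)) * exp (- c * t)) \<longlongrightarrow> 0) at_top" by simp
      qed (use assms in auto)
      finally show "(\<integral>\<^sup>+t. ennreal (2 / L * exp (- (\<beta> + 2 * ?\<mu> n) * t)) * indicator {0<..} t \<partial>lborel)
          \<le> ennreal (2 / L * (1 / (\<beta> + 2 * ?\<mu> n)))"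
        by (simp add: c_def)
    qed auto
    finally show ?thesis .
  qed
  have "summable (\<lambda>n. 2 / L * (1 / (2 * ?\<mu> n)))"
  proof -
    have "summable (\<lambda>n. 2 / L * (L\<^sup>2 / pi\<^sup>2) * (1 / (real n)\<^sup>2))"
      using inverse_power_summable[of 2] by (intro summable_mult) (simp add: field_simps)
    then show ?thesis
      by (simp add: neumann_eigenval_def power_divide power_mult_distrib mult_ac)
  qed
  from suminf_exist_split[OF _ this, of "e / 2"] assms
  obtain N where N: "\<And>n. n \<ge> N \<Longrightarrow> norm (\<Sum>i. 2 / L * (1 / (2 * ?\<mu> (i + n)))) < e / 2" by auto
  define M where "M = Suc N"
  \<comment> \<open>chosen such that \<open>M\<close> terms of size \<open>2 / (L \<beta>)\<close> add up to \<open>e / 2\<close>\<close>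
  define \<beta> where "\<beta> = 4 * real M / (L * e)"
  have \<beta>: "\<beta> > 0" using assms by (simp add: \<beta>_def M_def)
  let ?a = "\<lambda>n. 2 / L * (1 / (\<beta> + 2 * ?\<mu> n))" and ?b = "\<lambda>n. 2 / L * (1 / (2 * ?\<mu> n))"
  have sb: "summable ?b" by fact
  have ab: "?a (n + M) \<le> ?b (n + M)" for n
    using \<beta> assms by (intro mult_left_mono divide_left_mono) (auto simp: neumann_eigenval_def M_def intro!: mult_pos_pos add_pos_pos)
  have a0: "0 \<le> ?a n" for n
    using assms \<beta> by (intro mult_nonneg_nonneg) (auto intro!: divide_nonneg_nonneg add_nonneg_nonneg)
  have sa: "summable (\<lambda>n. ?a (n + M))"
    by (rule summable_comparison_test'[OF summable_ignore_initial_segment[OF sb, of M]])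
      (use ab a0 in \<open>simp add: abs_of_nonneg\<close>)
  then have sa': "summable ?a" by (subst (asm) summable_iff_shift)
  have "(\<Sum>n. ?a n) = (\<Sum>n. ?a (n + M)) + (\<Sum>n<M. ?a n)"
    by (rule suminf_split_initial_segment[OF sa'])
  also have "(\<Sum>n. ?a (n + M)) \<le> (\<Sum>n. ?b (n + M))"
    by (intro suminf_le sa summable_ignore_initial_segment[OF sb] ab)
  also have "\<dots> \<le> e / 2"
    using N[of M] by (simp add: M_def)
  also have "(\<Sum>n<M. ?a n) \<le> (\<Sum>n<M. 2 / L * (1 / \<beta>))"
    using \<beta> assms by (intro sum_mono mult_left_mono divide_left_mono) (auto intro!: mult_pos_pos add_pos_nonneg)
  also have "\<dots> = e / 2"
    using assms by (simp add: \<beta>_def M_def field_simps)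
  finally have "(\<Sum>n. ?a n) \<le> e" by simp
  moreover have "(\<Sum>n. ennreal (?a n)) = ennreal (\<Sum>n. ?a n)"
    by (rule suminf_ennreal2[OF a0 sa'])
  ultimately have "(\<Sum>n. ennreal (?a n)) \<le> ennreal e"
    using ennreal_leI by simp
  with Laplace[OF \<beta>] show ?thesis
    by (intro that[OF \<beta>]) (rule order_trans)
qed

definition heat_flow :: "real \<Rightarrow> (real \<Rightarrow> real) \<Rightarrow> real \<Rightarrow> real \<Rightarrow> real" where
  "heat_flow L f t x = (LINT y|lebesgue_on {0..L}. f y * neumann_heat_kernel L t x y)"

lemma heat_flow_bounded_after:
  assumes L: "L > 0" "t > 0" and f: "f \<in> borel_measurable (lebesgue_on {0..L})" "bounded (f ` {0..L})"
  obtains C where "\<And>s x. s \<ge> t \<Longrightarrow> \<bar>heat_flow L f s x\<bar> \<le> C"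
proof -
  let ?N = "lebesgue_on {0..L}"
  obtain C where C: "\<And>s x y. s \<ge> t \<Longrightarrow> \<bar>neumann_heat_kernel L s x y\<bar> \<le> C"
    using neumann_heat_kernel_bounded_after[OF L] by blast
  from f(2) have "\<exists>K. \<forall>y\<in>{0..L}. \<bar>f y\<bar> \<le> K"
    by (simp add: bounded_iff)
  then obtain K where K: "\<And>y. y \<in> {0..L} \<Longrightarrow> \<bar>f y\<bar> \<le> K" by blast
  have "\<bar>heat_flow L f s x\<bar> \<le> K * C * L" if s: "s \<ge> t" for s x
  proof -
    have KC: "\<bar>f y * neumann_heat_kernel L s x y\<bar> \<le> K * C" if "y \<in> {0..L}" for y
      unfolding abs_mult using K[OF that] C[OF s] by (intro mult_mono) (auto intro: order_trans[OF abs_ge_zero])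
    have "\<bar>heat_flow L f s x\<bar> \<le> (LINT y|?N. \<bar>f y * neumann_heat_kernel L s x y\<bar>)"
      unfolding heat_flow_def by (rule integral_abs_bound)
    also have "\<dots> \<le> (LINT y|?N. K * C)"
      by (intro integral_mono' KC) (use KC[of 0] L in \<open>auto intro!: order_trans[OF abs_ge_zero]\<close>)
    also have "\<dots> = K * C * L"
      using L by (simp add: measure_restrict_space)
    finally show ?thesis .
  qed
  then show ?thesis using that by blast
qed

lemma heat_flow_mass:
  assumes L: "L > 0" "t > 0" and f: "f \<in> borel_measurable (lebesgue_on {0..L})" "bounded (f ` {0..L})"
  shows "heat_flow L f t \<in> borel_measurable borel"
    and "set_integrable lborel {0<..<L} (heat_flow L f t)"
    and "bounded (range (heat_flow L f t))"
    and "(LINT x:{0<..<L}|lborel. heat_flow L f t x) = (LINT y|lebesgue_on {0..L}. f y)"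
proof -
  let ?N = "lebesgue_on {0..L}"
  interpret N: finite_measure ?N by (intro finite_measure_lebesgue_on) auto
  interpret P: pair_sigma_finite lborel ?N
    by unfold_locales
  note f(1) [measurable]
  have id [measurable]: "(\<lambda>y. y) \<in> borel_measurable ?N"
    by (rule measurable_restrict_space1) (simp add: measurable_completion)
  show meas [measurable]: "heat_flow L f t \<in> borel_measurable borel"
    unfolding heat_flow_def[abs_def] by measurable
  obtain C where C: "\<And>x y. \<bar>neumann_heat_kernel L t x y\<bar> \<le> C"
    using neumann_heat_kernel_bounded[OF L] by blast
  from f(2) have "\<exists>K. \<forall>y\<in>{0..L}. \<bar>f y\<bar> \<le> K"
    by (simp add: bounded_iff)
  then obtain K where K: "\<And>y. y \<in> {0..L} \<Longrightarrow> \<bar>f y\<bar> \<le> K" by blast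
  have KC: "\<bar>f y * neumann_heat_kernel L t x y\<bar> \<le> K * C" if "y \<in> {0..L}" for x y
    unfolding abs_mult using K[OF that] C by (intro mult_mono) (auto intro: order_trans[OF abs_ge_zero])
  obtain B where bnd: "\<And>x. \<bar>heat_flow L f t x\<bar> \<le> B"
    using heat_flow_bounded_after[OF L f] by (metis order_refl)
  then show "bounded (range (heat_flow L f t))" by (auto simp: bounded_iff)
  show "set_integrable lborel {0<..<L} (heat_flow L f t)"
    unfolding set_integrable_def
    by (rule integrableI_bounded_set[of "{0<..<L}" _ _ B]) (use bnd L in \<open>auto simp: indicator_def\<close>)
  let ?f = "\<lambda>x y. indicator {0<..<L} x * (f y * neumann_heat_kernel L t x y)"
  have i2: "integrable (lborel \<Otimes>\<^sub>M ?N) (case_prod ?f)"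
  proof (rule integrableI_bounded_set[of "{0<..<L} \<times> {0..L}" _ _ "K * C"])
    show "{0<..<L} \<times> {0..L} \<in> sets (lborel \<Otimes>\<^sub>M ?N)"
      by (intro pair_measureI) (auto simp: sets_restrict_space)
    have "{0..L} \<in> sets ?N" by (auto simp: sets_restrict_space)
    then show "emeasure (lborel \<Otimes>\<^sub>M ?N) ({0<..<L} \<times> {0..L}) < \<infinity>"
      using L N.emeasure_finite[of "{0..L}"]
      by (subst N.emeasure_pair_measure_Times) (auto simp: ennreal_mult_eq_top_iff less_top[symmetric])
    show "AE x in lborel \<Otimes>\<^sub>M ?N. x \<in> {0<..<L} \<times> {0..L} \<longrightarrow> norm (case_prod ?f x) \<le> K * C"
      by (auto simp: KC intro!: AE_I2)
    show "AE x in lborel \<Otimes>\<^sub>M ?N. x \<notin> {0<..<L} \<times> {0..L} \<longrightarrow> case_prod ?f x = 0"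
      by (auto simp: space_pair_measure indicator_def intro!: AE_I2)
  qed measurable
  have "(LINT x:{0<..<L}|lborel. heat_flow L f t x) = (\<integral>x. (\<integral>y. ?f x y \<partial>?N) \<partial>lborel)"
    unfolding set_lebesgue_integral_def heat_flow_def by simp
  also have "\<dots> = (\<integral>y. (\<integral>x. ?f x y \<partial>lborel) \<partial>?N)"
    by (rule P.Fubini_integral[OF i2, symmetric])
  also have "\<dots> = (\<integral>y. f y * (LINT x:{0<..<L}|lborel. neumann_heat_kernel L t x y) \<partial>?N)"
    unfolding set_lebesgue_integral_def by (simp add: mult.left_commute)
  also have "\<dots> = (\<integral>y. f y \<partial>?N)"
    by (simp add: neumann_heat_kernel_mass[OF L])
  finally show "(LINT x:{0<..<L}|lborel. heat_flow L f t x) = (LINT y|?N. f y)" .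
qed

text \<open>
  Conservation of mass and the Cauchy-Schwarz inequality, the latter from the square of the
  distance to the mean.
\<close>

lemma heat_flow_energy_lower:
  assumes L: "L > 0" "t > 0" and f: "f \<in> borel_measurable (lebesgue_on {0..L})" "bounded (f ` {0..L})"
  shows "ennreal ((LINT y|lebesgue_on {0..L}. f y)\<^sup>2 / L) \<le>
    (\<integral>\<^sup>+x\<in>{0<..<L}. ennreal ((heat_flow L f t x)\<^sup>2) \<partial>lborel)"
proof -
  let ?\<phi> = "heat_flow L f t" and ?m = "LINT y|lebesgue_on {0..L}. f y"
  note H = heat_flow_mass[OF L f]
  note H(1) [measurable]
  obtain B where B: "\<And>x. \<bar>?\<phi> x\<bar> \<le> B"
    using H(3) by (auto simp: bounded_iff)
  have B2: "(?\<phi> x)\<^sup>2 \<le> B\<^sup>2" for x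
    using B[of x] by (metis abs_ge_zero power2_abs power_mono)
  have i2: "integrable lborel (\<lambda>x. indicator {0<..<L} x * (?\<phi> x)\<^sup>2)"
    by (rule integrableI_bounded_set[of "{0<..<L}" _ _ "B\<^sup>2"]) (use B2 L in \<open>auto simp: indicator_def\<close>)
  have i1: "integrable lborel (\<lambda>x. indicator {0<..<L} x * ?\<phi> x)"
    using H(2) by (simp add: set_integrable_def)
  have i0: "integrable lborel (\<lambda>x. indicat_real {0<..<L} x)"
    using L by simp
  have m: "(\<integral>x. indicator {0<..<L} x * ?\<phi> x \<partial>lborel) = ?m"
    using H(4) by (simp add: set_lebesgue_integral_def)
  let ?c = "?m / L"
  \<comment> \<open>the constant \<open>?c\<close> is the spatial mean of \<open>?\<phi>\<close>\<close>
  have "0 \<le> (\<integral>x. indicator {0<..<L} x * (?\<phi> x - ?c)\<^sup>2 \<partial>lborel)"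
    by (rule Bochner_Integration.integral_nonneg) simp
  also have "\<dots> = (\<integral>x. indicator {0<..<L} x * (?\<phi> x)\<^sup>2 - 2 * ?c * (indicator {0<..<L} x * ?\<phi> x)
      + ?c\<^sup>2 * indicator {0<..<L} x \<partial>lborel)"
    by (intro Bochner_Integration.integral_cong refl) (simp add: power2_diff algebra_simps)
  also have "\<dots> = (\<integral>x. indicator {0<..<L} x * (?\<phi> x)\<^sup>2 \<partial>lborel) - 2 * ?c * ?m + ?c\<^sup>2 * L"
    using i2 i1 i0 L m by simp
  also have "\<dots> = (\<integral>x. indicator {0<..<L} x * (?\<phi> x)\<^sup>2 \<partial>lborel) - ?m\<^sup>2 / L"
    using L by (simp add: field_simps power2_eq_square)
  finally have "ennreal (?m\<^sup>2 / L) \<le> ennreal (\<integral>x. indicator {0<..<L} x * (?\<phi> x)\<^sup>2 \<partial>lborel)"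
    by (intro ennreal_leI) simp
  also have "\<dots> = (\<integral>\<^sup>+x. ennreal (indicator {0<..<L} x * (?\<phi> x)\<^sup>2) \<partial>lborel)"
    by (rule nn_integral_eq_integral[symmetric, OF i2]) simp
  also have "\<dots> = (\<integral>\<^sup>+x\<in>{0<..<L}. ennreal ((?\<phi> x)\<^sup>2) \<partial>lborel)"
    by (intro nn_integral_cong) (auto simp: indicator_def)
  finally show ?thesis .
qed

lemma integral_pos_of_support:
  fixes f :: "real \<Rightarrow> real"
  assumes f: "f \<in> borel_measurable (lebesgue_on {0..L})" "bounded (f ` {0..L})"
    and nn: "\<And>x. x \<in> {0..L} \<Longrightarrow> 0 \<le> f x" and supp: "0 < emeasure lebesgue {x \<in> {0..L}. 0 < f x}"
  shows "0 < (LINT y|lebesgue_on {0..L}. f y)"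
proof -
  let ?N = "lebesgue_on {0..L}"
  interpret N: finite_measure ?N by (intro finite_measure_lebesgue_on) auto
  note f(1) [measurable]
  from f(2) have "\<exists>K. \<forall>y\<in>{0..L}. \<bar>f y\<bar> \<le> K"
    by (simp add: bounded_iff)
  then obtain K where K: "\<And>y. y \<in> {0..L} \<Longrightarrow> \<bar>f y\<bar> \<le> K" by blast
  have fi: "integrable ?N f"
    by (rule N.integrable_const_bound[of _ K]) (use K in \<open>auto intro!: AE_I2\<close>)
  have nn': "AE x in ?N. 0 \<le> f x" using nn by (auto intro!: AE_I2)
  have "(LINT y|?N. f y) \<noteq> 0"
  proof
    assume "(LINT y|?N. f y) = 0"
    then have "AE x in ?N. f x = 0"
      using integral_nonneg_eq_0_iff_AE[OF fi nn'] by simp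
    then have "AE x in ?N. \<not> 0 < f x" by eventually_elim simp
    moreover have "{x \<in> space ?N. 0 < f x} \<in> sets ?N"
      by measurable
    ultimately have "emeasure ?N {x \<in> space ?N. 0 < f x} = 0"
      by (subst (asm) AE_iff_measurable) auto
    moreover have "emeasure ?N {x \<in> space ?N. 0 < f x} = emeasure lebesgue {x \<in> {0..L}. 0 < f x}"
      by (subst emeasure_restrict_space) auto
    ultimately show False using supp by simp
  qed
  moreover have "0 \<le> (LINT y|?N. f y)" by (rule integral_nonneg_AE[OF nn'])
  ultimately show ?thesis by simp
qed

section \<open>Volterra inequalities\<close>

text \<open>
  In each time step of length \<open>2 / \<kappa>\<close> a lower bound for \<open>G\<close> contributes twice its value to the right
  hand side, so the bound doubles.
\<close>

lemma volterra_exponential_lower: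
  fixes G :: "real \<Rightarrow> ennreal"
  assumes c: "c > 0" and \<kappa>: "\<kappa> > 0"
    and G: "\<And>t. t > 0 \<Longrightarrow> ennreal c + ennreal \<kappa> * (\<integral>\<^sup>+s\<in>{..<t}. G s \<partial>lborel) \<le> G t"
    and t: "t > 0"
  shows "ennreal (c * 2 powr (\<kappa> * t / 2 - 1)) \<le> G t"
proof -
  have doubling: "ennreal (c * 2 ^ n) \<le> G t" if "t > 0" "2 * real n / \<kappa> \<le> t" for n t
    using that
  proof (induction n arbitrary: t)
    case 0
    have "ennreal c \<le> ennreal c + ennreal \<kappa> * (\<integral>\<^sup>+s\<in>{..<t}. G s \<partial>lborel)" by simp
    also have "\<dots> \<le> G t" by (rule G) fact
    finally show ?case by simp
  next
    case (Suc n)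
    let ?S = "{2 * real n / \<kappa><..<2 * real (Suc n) / \<kappa>}"
    have len: "2 * real (Suc n) / \<kappa> - 2 * real n / \<kappa> = 2 / \<kappa>" "2 * real n / \<kappa> \<le> 2 * real (Suc n) / \<kappa>"
      using \<kappa> by (simp_all add: field_simps)
    have "ennreal (c * 2 ^ n) * ennreal (2 / \<kappa>) = (\<integral>\<^sup>+s\<in>?S. ennreal (c * 2 ^ n) \<partial>lborel)"
      using len by (simp add: nn_integral_cmult_indicator)
    also have "\<dots> \<le> (\<integral>\<^sup>+s\<in>{..<t}. G s \<partial>lborel)"
    proof (rule nn_integral_mono)
      fix s :: real
      have "ennreal (c * 2 ^ n) \<le> G s" "s < t" if "s \<in> ?S"
      proof -
        have "0 \<le> 2 * real n / \<kappa>" using \<kappa> by simp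
        then have "0 < s" "2 * real n / \<kappa> \<le> s" using that by auto
        then show "ennreal (c * 2 ^ n) \<le> G s" by (rule Suc.IH)
        show "s < t" using that Suc.prems by auto
      qed
      then show "ennreal (c * 2 ^ n) * indicator ?S s \<le> G s * indicator {..<t} s"
        by (auto simp: indicator_def)
    qed
    finally have *: "ennreal \<kappa> * (ennreal (c * 2 ^ n) * ennreal (2 / \<kappa>)) \<le> ennreal \<kappa> * (\<integral>\<^sup>+s\<in>{..<t}. G s \<partial>lborel)"
      by (rule mult_left_mono) simp
    have "ennreal (c * 2 ^ Suc n) = ennreal \<kappa> * (ennreal (c * 2 ^ n) * ennreal (2 / \<kappa>))"
      using c \<kappa> by (simp add: ennreal_mult[symmetric])
    also note *
    also have "ennreal \<kappa> * (\<integral>\<^sup>+s\<in>{..<t}. G s \<partial>lborel) \<le> ennreal c + ennreal \<kappa> * (\<integral>\<^sup>+s\<in>{..<t}. G s \<partial>lborel)"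
      by simp
    also have "\<dots> \<le> G t" by (rule G) fact
    finally show ?case .
  qed
  \<comment> \<open>number of completed doubling steps\<close>
  define n where "n = nat \<lfloor>\<kappa> * t / 2\<rfloor>"
  have n: "real n \<le> \<kappa> * t / 2" "\<kappa> * t / 2 - 1 \<le> real n"
    using \<kappa> t by (simp_all add: n_def) linarith+
  have "c * 2 powr (\<kappa> * t / 2 - 1) \<le> c * 2 powr real n"
    using c n by (intro mult_left_mono) auto
  also have "\<dots> = c * 2 ^ n" by (simp add: powr_realpow)
  finally have "ennreal (c * 2 powr (\<kappa> * t / 2 - 1)) \<le> ennreal (c * 2 ^ n)"
    by (rule ennreal_leI)
  also have "\<dots> \<le> G t"
    using n \<kappa> t by (intro doubling) (simp_all add: field_simps)
  finally show ?thesis .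
qed

text \<open>
  The weight \<open>exp (- \<beta> t)\<close> turns the convolution into a contraction.  With \<open>S\<close> the supremum of the
  weighted function on \<open>(0, T]\<close> the hypotheses give \<open>S \<le> A + S / 2\<close>, and \<open>S \<le> 2 A\<close> follows since
  local boundedness makes \<open>S\<close> finite.
\<close>

lemma volterra_exponential_upper:
  fixes G k :: "real \<Rightarrow> ennreal" and A \<beta> :: real
  assumes [measurable]: "G \<in> borel_measurable borel" "k \<in> borel_measurable borel" and A: "A \<ge> 0" and \<beta>: "\<beta> > 0"
    and k: "(\<integral>\<^sup>+r\<in>{0<..}. ennreal (exp (- \<beta> * r)) * k r \<partial>lborel) \<le> ennreal (1 / 2)"
    and G: "\<And>t. t > 0 \<Longrightarrow> G t \<le> ennreal A + (\<integral>\<^sup>+s\<in>{..<t}. k (t - s) * G s \<partial>lborel)"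
    and G0: "\<And>t. t \<le> 0 \<Longrightarrow> G t = 0"
    and loc: "\<And>T. T > 0 \<Longrightarrow> \<exists>C. \<forall>t\<in>{0<..T}. G t \<le> ennreal C"
    and t: "t > 0"
  shows "G t \<le> ennreal (2 * A * exp (\<beta> * t))"
proof -
  define T where "T = t"
  have T: "T > 0" using t by (simp add: T_def)
  let ?g = "\<lambda>t. ennreal (exp (- \<beta> * t)) * G t"
  define S where "S = (SUP t\<in>{0<..T}. ?g t)"
  have gS: "?g s \<le> S" if "s \<le> T" for s
  proof (cases "s > 0")
    case True
    then show ?thesis unfolding S_def using that by (intro SUP_upper) auto
  qed (simp add: G0)
  obtain C where C: "\<And>t. t \<in> {0<..T} \<Longrightarrow> G t \<le> ennreal C" using loc[OF T] by blast
  have "S \<le> ennreal C"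
    unfolding S_def
  proof (rule SUP_least)
    fix t assume t: "t \<in> {0<..T}"
    then have "ennreal (exp (- \<beta> * t)) \<le> 1" using \<beta> by simp
    then have "?g t \<le> 1 * G t" by (intro mult_right_mono) auto
    with C[OF t] show "?g t \<le> ennreal C" by simp
  qed
  then have Sfin: "S < \<infinity>" by (rule le_less_trans) simp
  have "S \<le> ennreal A + ennreal (1 / 2) * S"
    unfolding S_def
  proof (rule SUP_least, fold S_def)
    fix t assume t: "t \<in> {0<..T}"
    let ?e = "ennreal (exp (- \<beta> * t))"
    have "?e * (\<integral>\<^sup>+s\<in>{..<t}. k (t - s) * G s \<partial>lborel)
        = (\<integral>\<^sup>+s. ?e * (k (t - s) * G s * indicator {..<t} s) \<partial>lborel)"
      by (rule nn_integral_cmult[symmetric]) measurable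
    also have "\<dots> \<le> (\<integral>\<^sup>+s. (ennreal (exp (- \<beta> * (t - s))) * k (t - s) * indicator {0<..} (t - s)) * S \<partial>lborel)"
    proof (rule nn_integral_mono)
      fix s
      show "?e * (k (t - s) * G s * indicator {..<t} s) \<le>
        (ennreal (exp (- \<beta> * (t - s))) * k (t - s) * indicator {0<..} (t - s)) * S"
      proof (cases "s < t")
        case True
        have "?e = ennreal (exp (- \<beta> * (t - s))) * ennreal (exp (- \<beta> * s))"
          by (simp add: ennreal_mult[symmetric] exp_add[symmetric] algebra_simps)
        then have "?e * (k (t - s) * G s) = ennreal (exp (- \<beta> * (t - s))) * k (t - s) * ?g s"
          by (simp add: mult_ac)
        also have "\<dots> \<le> ennreal (exp (- \<beta> * (t - s))) * k (t - s) * S"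
          using True t by (intro mult_left_mono gS) auto
        finally show ?thesis using True by simp
      qed simp
    qed
    also have "\<dots> = (\<integral>\<^sup>+s. ennreal (exp (- \<beta> * (t - s))) * k (t - s) * indicator {0<..} (t - s) \<partial>lborel) * S"
      by (rule nn_integral_multc) measurable
    also have "(\<integral>\<^sup>+s. ennreal (exp (- \<beta> * (t - s))) * k (t - s) * indicator {0<..} (t - s) \<partial>lborel)
        = (\<integral>\<^sup>+r\<in>{0<..}. ennreal (exp (- \<beta> * r)) * k r \<partial>lborel)"
      by (subst (2) nn_integral_real_affine[where t = t and c = "- 1"]) auto
    also have "\<dots> * S \<le> ennreal (1 / 2) * S"
      by (intro mult_right_mono k) simp
    finally have *: "?e * (\<integral>\<^sup>+s\<in>{..<t}. k (t - s) * G s \<partial>lborel) \<le> ennreal (1 / 2) * S" .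
    have "?e \<le> 1" using t \<beta> by simp
    then have "?e * ennreal A \<le> 1 * ennreal A" by (intro mult_right_mono) auto
    moreover have "?g t \<le> ?e * (ennreal A + (\<integral>\<^sup>+s\<in>{..<t}. k (t - s) * G s \<partial>lborel))"
      using t by (intro mult_left_mono G) auto
    ultimately show "?g t \<le> ennreal A + ennreal (1 / 2) * S"
      using * by (auto simp: distrib_left intro: order_trans add_mono)
  qed
  moreover obtain s where s: "S = ennreal s" "s \<ge> 0"
    using Sfin by (cases S) auto
  moreover have "ennreal A + ennreal (1 / 2) * ennreal s = ennreal (A + 1 / 2 * s)"
    using A s by (subst ennreal_mult[symmetric]) auto
  ultimately have "ennreal s \<le> ennreal (A + 1 / 2 * s)" by (simp only:)
  then have "s \<le> A + 1 / 2 * s"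
    using A s by (subst (asm) ennreal_le_iff) auto
  then have "s \<le> 2 * A" by simp
  then have "?g T \<le> ennreal (2 * A)"
    using gS[of T] s ennreal_leI order_trans by fastforce
  then have "ennreal (exp (\<beta> * T)) * ?g T \<le> ennreal (exp (\<beta> * T)) * ennreal (2 * A)"
    by (intro mult_left_mono) auto
  moreover have "ennreal (exp (\<beta> * T)) * ?g T = G T"
    by (simp add: mult.assoc[symmetric] ennreal_mult[symmetric] exp_add[symmetric])
  ultimately show ?thesis
    using A by (simp add: ennreal_mult[symmetric] mult_ac T_def)
qed

section \<open>Growth of the energy\<close>

locale stochastic_heat_solution = walsh_noise M L W F
  for M :: "'a measure" and L W F +
  fixes \<sigma> u\<^sub>0 :: "real \<Rightarrow> real" and l\<^sub>\<sigma> L\<^sub>\<sigma> K lam :: real and u :: "real \<Rightarrow> real \<Rightarrow> 'a \<Rightarrow> real"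
  assumes L: "L > 0" and lipschitz: "K-lipschitz_on UNIV \<sigma>"
    and l: "l\<^sub>\<sigma> > 0" and u_growth: "L\<^sub>\<sigma> > 0"
    and \<sigma>_bounds: "\<And>x. l\<^sub>\<sigma> * \<bar>x\<bar> \<le> \<bar>\<sigma> x\<bar> \<and> \<bar>\<sigma> x\<bar> \<le> L\<^sub>\<sigma> * \<bar>x\<bar>"
    and init: "u\<^sub>0 \<in> borel_measurable (lebesgue_on {0..L})" "bounded (u\<^sub>0 ` {0..L})"
    and init_pos: "0 < (LINT y|lebesgue_on {0..L}. u\<^sub>0 y)"
    and lam: "lam > 0" and mild: "mild_solution M L W F \<sigma> u\<^sub>0 lam u"
begin

abbreviation D where "D \<equiv> noise_domain L"

text \<open>
  The field is cut off outside \<open>noise_domain L\<close>, where predictability says nothing about it.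
  The parameter \<open>\<phi>\<close> is the identity or \<open>\<sigma>\<close>.
\<close>

definition second_moment :: "(real \<Rightarrow> real) \<Rightarrow> real \<times> real \<Rightarrow> ennreal" where
  "second_moment \<phi> z = (\<integral>\<^sup>+\<omega>. ennreal ((\<phi> (u (fst z) (snd z) \<omega> * indicator D z))\<^sup>2) \<partial>M)"

definition mean_energy :: "real \<Rightarrow> ennreal" where
  "mean_energy t = (\<integral>\<^sup>+y. second_moment (\<lambda>x. x) (t, y) \<partial>lborel)"

lemma \<sigma>_measurable [measurable]: "\<sigma> \<in> borel_measurable borel"
  using lipschitz_on_continuous_on[OF lipschitz] by (rule borel_measurable_continuous_onI)

lemma \<sigma>_0 [simp]: "\<sigma> 0 = 0"
  using \<sigma>_bounds[of 0] by simp

lemma u_measurable: "(\<lambda>(z, \<omega>). u (fst z) (snd z) \<omega> * indicator D z) \<in> borel_measurable (borel \<Otimes>\<^sub>M M)"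
  using mild by (intro predictable_field_measurable) (simp add: mild_solution_def)

lemma u_comp_measurable:
  assumes "f \<in> borel_measurable N" "g \<in> measurable N M"
  shows "(\<lambda>w. u (fst (f w)) (snd (f w)) (g w) * indicator D (f w)) \<in> borel_measurable N"
  using measurable_compose[OF measurable_Pair[OF assms] u_measurable] by simp

lemma second_moment_measurable [measurable]:
  assumes [measurable]: "\<phi> \<in> borel_measurable borel"
  shows "second_moment \<phi> \<in> borel_measurable borel"
proof -
  note u_measurable [measurable]
  have "(\<lambda>w. ennreal ((\<phi> (case w of (z, \<omega>) \<Rightarrow> u (fst z) (snd z) \<omega> * indicator D z))\<^sup>2)) \<in> borel_measurable (borel \<Otimes>\<^sub>M M)"
    by measurable
  then show ?thesis
    unfolding second_moment_def[abs_def]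
    by (intro borel_measurable_nn_integral) (simp add: case_prod_beta)
qed

lemma second_moment_outside: "z \<notin> D \<Longrightarrow> \<phi> 0 = 0 \<Longrightarrow> second_moment \<phi> z = 0"
  by (simp add: second_moment_def)

lemma mean_energy_measurable [measurable]: "mean_energy \<in> borel_measurable borel"
proof -
  note second_moment_measurable[of "\<lambda>x. x", folded borel_prod, simplified, measurable]
  show ?thesis unfolding mean_energy_def[abs_def] by measurable
qed

lemma mean_energy_nonpos: "t \<le> 0 \<Longrightarrow> mean_energy t = 0"
  unfolding mean_energy_def by (simp add: second_moment_outside noise_domain_def)

lemma second_moment_\<sigma>:
  "ennreal (l\<^sub>\<sigma>\<^sup>2) * second_moment (\<lambda>x. x) z \<le> second_moment \<sigma> z"
  "second_moment \<sigma> z \<le> ennreal (L\<^sub>\<sigma>\<^sup>2) * second_moment (\<lambda>x. x) z"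
proof -
  have m: "(\<lambda>\<omega>. u (fst z) (snd z) \<omega> * indicator D z) \<in> borel_measurable M"
    using u_comp_measurable[of "\<lambda>_. z" M "\<lambda>\<omega>. \<omega>"] by simp
  have lo: "l\<^sub>\<sigma>\<^sup>2 * x\<^sup>2 \<le> (\<sigma> x)\<^sup>2" for x
    using power_mono[of "l\<^sub>\<sigma> * \<bar>x\<bar>" "\<bar>\<sigma> x\<bar>" 2] \<sigma>_bounds[of x] l by (simp add: power_mult_distrib)
  have hi: "(\<sigma> x)\<^sup>2 \<le> L\<^sub>\<sigma>\<^sup>2 * x\<^sup>2" for x
    using power_mono[of "\<bar>\<sigma> x\<bar>" "L\<^sub>\<sigma> * \<bar>x\<bar>" 2] \<sigma>_bounds[of x] by (simp add: power_mult_distrib)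
  have e: "ennreal c * second_moment (\<lambda>x. x) z = (\<integral>\<^sup>+\<omega>. ennreal (c * (u (fst z) (snd z) \<omega> * indicator D z)\<^sup>2) \<partial>M)"
    if "c \<ge> 0" for c
    unfolding second_moment_def using m that
    by (subst nn_integral_cmult[symmetric]) (simp_all add: ennreal_mult)
  show "ennreal (l\<^sub>\<sigma>\<^sup>2) * second_moment (\<lambda>x. x) z \<le> second_moment \<sigma> z"
    unfolding e[OF zero_le_power2] unfolding second_moment_def by (intro nn_integral_mono ennreal_leI lo)
  show "second_moment \<sigma> z \<le> ennreal (L\<^sub>\<sigma>\<^sup>2) * second_moment (\<lambda>x. x) z"
    unfolding e[OF zero_le_power2] unfolding second_moment_def by (intro nn_integral_mono ennreal_leI hi)
qed

text \<open>
  The stochastic integral is centred, so the cross term with the deterministic part vanishes, and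
  the isometry evaluates its second moment.
\<close>

lemma second_moment_mild:
  assumes t: "t > 0" and x: "x \<in> {0<..<L}"
  shows "second_moment (\<lambda>x. x) (t, x) = ennreal ((heat_flow L u\<^sub>0 t x)\<^sup>2) +
    ennreal (lam\<^sup>2) * (\<integral>\<^sup>+z. ennreal ((neumann_heat_kernel L (t - fst z) x (snd z))\<^sup>2) *
      indicator {..<t} (fst z) * second_moment \<sigma> z \<partial>lborel)"
proof -
  let ?a = "heat_flow L u\<^sub>0 t x" and ?p = "\<lambda>z. neumann_heat_kernel L (t - fst z) x (snd z)"
  let ?f = "\<lambda>s y \<omega>. if s < t then neumann_heat_kernel L (t - s) x y * \<sigma> (u s y \<omega>) else 0"
  obtain I where I: "has_walsh_integral M L W F ?f I"
    and uI: "AE \<omega> in M. u t x \<omega> = ?a + lam * I \<omega>"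
    using mild t x unfolding mild_solution_def heat_flow_def by blast
  note iso = walsh_isometry[OF I]
  interpret P: pair_sigma_finite "lborel :: (real \<times> real) measure" M
    by unfold_locales
  have "second_moment (\<lambda>x. x) (t, x) = (\<integral>\<^sup>+\<omega>. ennreal ((u t x \<omega>)\<^sup>2) \<partial>M)"
    using t x by (simp add: second_moment_def noise_domain_def)
  also have "\<dots> = (\<integral>\<^sup>+\<omega>. ennreal ((?a + lam * I \<omega>)\<^sup>2) \<partial>M)"
    using uI by (intro nn_integral_cong_AE) (auto elim: eventually_mono)
  also have "\<dots> = (\<integral>\<^sup>+\<omega>. ennreal (?a\<^sup>2 + 2 * ?a * lam * I \<omega> + lam\<^sup>2 * (I \<omega>)\<^sup>2) \<partial>M)"
    by (simp add: power2_sum power_mult_distrib algebra_simps)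
  also have "\<dots> = ennreal (expectation (\<lambda>\<omega>. ?a\<^sup>2 + 2 * ?a * lam * I \<omega> + lam\<^sup>2 * (I \<omega>)\<^sup>2))"
  proof (rule nn_integral_eq_integral)
    show "integrable M (\<lambda>\<omega>. ?a\<^sup>2 + 2 * ?a * lam * I \<omega> + lam\<^sup>2 * (I \<omega>)\<^sup>2)"
      using iso by simp
    have "?a\<^sup>2 + 2 * ?a * lam * c + lam\<^sup>2 * c\<^sup>2 = (?a + lam * c)\<^sup>2" for c
      by (simp add: power2_sum power_mult_distrib)
    then show "AE \<omega> in M. 0 \<le> ?a\<^sup>2 + 2 * ?a * lam * I \<omega> + lam\<^sup>2 * (I \<omega>)\<^sup>2" by simp
  qed
  also have "expectation (\<lambda>\<omega>. ?a\<^sup>2 + 2 * ?a * lam * I \<omega> + lam\<^sup>2 * (I \<omega>)\<^sup>2) =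
      ?a\<^sup>2 + lam\<^sup>2 * expectation (\<lambda>\<omega>. (I \<omega>)\<^sup>2)"
    using iso by (simp add: prob_space)
  also have "ennreal \<dots> = ennreal (?a\<^sup>2) + ennreal (lam\<^sup>2) * ennreal (expectation (\<lambda>\<omega>. (I \<omega>)\<^sup>2))"
    by (simp add: ennreal_mult)
  also have "ennreal (expectation (\<lambda>\<omega>. (I \<omega>)\<^sup>2)) =
      (\<integral>\<^sup>+\<omega>. (\<integral>\<^sup>+z. (ennreal ((?p z)\<^sup>2) * indicator {..<t} (fst z)) *
         ennreal ((\<sigma> (u (fst z) (snd z) \<omega> * indicator D z))\<^sup>2) \<partial>lborel) \<partial>M)"
    unfolding iso(4)
    by (intro nn_integral_cong) (auto simp: indicator_def power_mult_distrib ennreal_mult)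
  also have "\<dots> = (\<integral>\<^sup>+z. (\<integral>\<^sup>+\<omega>. (ennreal ((?p z)\<^sup>2) * indicator {..<t} (fst z)) *
         ennreal ((\<sigma> (u (fst z) (snd z) \<omega> * indicator D z))\<^sup>2) \<partial>M) \<partial>lborel)"
  proof (rule P.Fubini')
    note u_measurable [folded borel_prod, measurable]
    have "(\<lambda>w. ennreal ((?p (fst w))\<^sup>2) * indicator {..<t} (fst (fst w)) *
         ennreal ((\<sigma> (case w of (z, \<omega>) \<Rightarrow> u (fst z) (snd z) \<omega> * indicator D z))\<^sup>2))
       \<in> borel_measurable ((borel \<Otimes>\<^sub>M borel) \<Otimes>\<^sub>M M)"
      by measurable
    then show "(\<lambda>(z, \<omega>). ennreal ((?p z)\<^sup>2) * indicator {..<t} (fst z) *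
         ennreal ((\<sigma> (u (fst z) (snd z) \<omega> * indicator D z))\<^sup>2)) \<in> borel_measurable (lborel \<Otimes>\<^sub>M M)"
      by (simp add: borel_prod case_prod_beta measurable_cong_sets[OF sets_pair_measure_cong[OF sets_lborel refl] refl])
  qed
  also have "\<dots> = (\<integral>\<^sup>+z. ennreal ((?p z)\<^sup>2) * indicator {..<t} (fst z) * second_moment \<sigma> z \<partial>lborel)"
    unfolding second_moment_def
  proof (intro nn_integral_cong nn_integral_cmult)
    fix z
    have [measurable]: "(\<lambda>\<omega>. u (fst z) (snd z) \<omega> * indicator D z) \<in> borel_measurable M"
      using u_comp_measurable[of "\<lambda>_. z" M "\<lambda>\<omega>. \<omega>"] by simp
    show "(\<lambda>\<omega>. ennreal ((\<sigma> (u (fst z) (snd z) \<omega> * indicator D z))\<^sup>2)) \<in> borel_measurable M"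
      by measurable
  qed
  finally show ?thesis .
qed

text \<open>
  Integrating over \<open>x\<close> first leaves the heat kernel only through \<open>heat_kernel_energy\<close>, whose bounds
  do not depend on \<open>y\<close>.  The equation therefore closes up in the spatially integrated energy.
\<close>

lemma mean_energy_renewal:
  assumes t: "t > 0"
  shows "mean_energy t = (\<integral>\<^sup>+x\<in>{0<..<L}. ennreal ((heat_flow L u\<^sub>0 t x)\<^sup>2) \<partial>lborel) +
    ennreal (lam\<^sup>2) * (\<integral>\<^sup>+s\<in>{..<t}. (\<integral>\<^sup>+y. heat_kernel_energy L (t - s) y * second_moment \<sigma> (s, y) \<partial>lborel) \<partial>lborel)"
proof -
  let ?p = "\<lambda>x z. ennreal ((neumann_heat_kernel L (t - fst z) x (snd z))\<^sup>2)"
  let ?F = "\<lambda>x z. ?p x z * indicator {0<..<L} x * (indicator {..<t} (fst z) * second_moment \<sigma> z)"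
  note heat_flow_mass(1)[OF L t init, measurable]
  note second_moment_measurable[OF \<sigma>_measurable, folded borel_prod, measurable]
  have "case_prod ?F \<in> borel_measurable (borel \<Otimes>\<^sub>M (borel \<Otimes>\<^sub>M borel))"
    by measurable
  then have Fm: "case_prod ?F \<in> borel_measurable (lborel \<Otimes>\<^sub>M lborel)"
    by (simp add: borel_prod measurable_cong_sets[OF sets_pair_measure_cong[OF sets_lborel sets_lborel] refl])
  have "mean_energy t = (\<integral>\<^sup>+x. ennreal ((heat_flow L u\<^sub>0 t x)\<^sup>2) * indicator {0<..<L} x +
      ennreal (lam\<^sup>2) * (\<integral>\<^sup>+z. ?F x z \<partial>lborel) \<partial>lborel)"
    unfolding mean_energy_def
  proof (rule nn_integral_cong)
    fix x :: real
    show "second_moment (\<lambda>x. x) (t, x) = ennreal ((heat_flow L u\<^sub>0 t x)\<^sup>2) * indicator {0<..<L} x +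
      ennreal (lam\<^sup>2) * (\<integral>\<^sup>+z. ?F x z \<partial>lborel)"
    proof (cases "x \<in> {0<..<L}")
      case True
      then show ?thesis using second_moment_mild[OF t True] by (simp add: mult.assoc)
    next
      case False
      then have "(t, x) \<notin> D" by (auto simp: noise_domain_def)
      with False show ?thesis by (simp add: second_moment_outside)
    qed
  qed
  also have "\<dots> = (\<integral>\<^sup>+x\<in>{0<..<L}. ennreal ((heat_flow L u\<^sub>0 t x)\<^sup>2) \<partial>lborel) +
      ennreal (lam\<^sup>2) * (\<integral>\<^sup>+x. \<integral>\<^sup>+z. ?F x z \<partial>lborel \<partial>lborel)"
    using lborel.borel_measurable_nn_integral[OF Fm]
    by (subst nn_integral_add) (auto simp: nn_integral_cmult)
  also have "(\<integral>\<^sup>+x. \<integral>\<^sup>+z. ?F x z \<partial>lborel \<partial>lborel) = (\<integral>\<^sup>+z. \<integral>\<^sup>+x. ?F x z \<partial>lborel \<partial>lborel)"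
    by (rule lborel_pair.Fubini'[OF Fm, symmetric])
  also have "\<dots> = (\<integral>\<^sup>+z. heat_kernel_energy L (t - fst z) (snd z) * (indicator {..<t} (fst z) * second_moment \<sigma> z) \<partial>lborel)"
    unfolding heat_kernel_energy_def by (intro nn_integral_cong nn_integral_multc) measurable
  also have "\<dots> = (\<integral>\<^sup>+z. heat_kernel_energy L (t - fst z) (snd z) * (indicator {..<t} (fst z) * second_moment \<sigma> z)
      \<partial>(lborel \<Otimes>\<^sub>M lborel))"
    by (simp only: lborel_prod)
  also have "\<dots> = (\<integral>\<^sup>+s. \<integral>\<^sup>+y. heat_kernel_energy L (t - s) y * (indicator {..<t} s * second_moment \<sigma> (s, y)) \<partial>lborel \<partial>lborel)"
  proof (subst lborel.nn_integral_fst[symmetric])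
    have "(\<lambda>z. heat_kernel_energy L (t - fst z) (snd z) * (indicator {..<t} (fst z) * second_moment \<sigma> z))
        \<in> borel_measurable (borel \<Otimes>\<^sub>M borel)"
      unfolding heat_kernel_energy_def by measurable
    then show "(\<lambda>z. heat_kernel_energy L (t - fst z) (snd z) * (indicator {..<t} (fst z) * second_moment \<sigma> z))
        \<in> borel_measurable (lborel \<Otimes>\<^sub>M lborel)"
      by (simp only: measurable_cong_sets[OF sets_pair_measure_cong[OF sets_lborel sets_lborel] refl])
  qed simp
  also have "\<dots> = (\<integral>\<^sup>+s\<in>{..<t}. (\<integral>\<^sup>+y. heat_kernel_energy L (t - s) y * second_moment \<sigma> (s, y) \<partial>lborel) \<partial>lborel)"
    by (intro nn_integral_cong) (auto simp: indicator_def)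
  finally show ?thesis .
qed

lemma mean_energy_lower:
  assumes t: "t > 0"
  shows "ennreal ((LINT y|lebesgue_on {0..L}. u\<^sub>0 y)\<^sup>2 / L) +
    ennreal (lam\<^sup>2 * l\<^sub>\<sigma>\<^sup>2 / L) * (\<integral>\<^sup>+s\<in>{..<t}. mean_energy s \<partial>lborel) \<le> mean_energy t"
proof -
  have "ennreal (lam\<^sup>2 * l\<^sub>\<sigma>\<^sup>2 / L) * (\<integral>\<^sup>+s\<in>{..<t}. mean_energy s \<partial>lborel) =
      ennreal (lam\<^sup>2) * (\<integral>\<^sup>+s. ennreal (l\<^sub>\<sigma>\<^sup>2 / L) * (mean_energy s * indicator {..<t} s) \<partial>lborel)"
    using L by (subst nn_integral_cmult) (simp_all add: mult.assoc[symmetric] ennreal_mult[symmetric])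
  also have "\<dots> \<le> ennreal (lam\<^sup>2) *
      (\<integral>\<^sup>+s\<in>{..<t}. (\<integral>\<^sup>+y. heat_kernel_energy L (t - s) y * second_moment \<sigma> (s, y) \<partial>lborel) \<partial>lborel)"
  proof (intro mult_left_mono nn_integral_mono)
    fix s :: real
    show "ennreal (l\<^sub>\<sigma>\<^sup>2 / L) * (mean_energy s * indicator {..<t} s) \<le>
      (\<integral>\<^sup>+y. heat_kernel_energy L (t - s) y * second_moment \<sigma> (s, y) \<partial>lborel) * indicator {..<t} s"
    proof (cases "s < t")
      case True
      have "ennreal (l\<^sub>\<sigma>\<^sup>2 / L) * mean_energy s =
          (\<integral>\<^sup>+y. ennreal (1 / L) * (ennreal (l\<^sub>\<sigma>\<^sup>2) * second_moment (\<lambda>x. x) (s, y)) \<partial>lborel)"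
        unfolding mean_energy_def using L
        by (subst nn_integral_cmult[symmetric], measurable) (simp add: mult.assoc[symmetric] ennreal_mult[symmetric])
      also have "\<dots> \<le> (\<integral>\<^sup>+y. heat_kernel_energy L (t - s) y * second_moment \<sigma> (s, y) \<partial>lborel)"
        using True L by (intro nn_integral_mono mult_mono heat_kernel_energy_lower second_moment_\<sigma>) auto
      finally show ?thesis using True by simp
    qed simp
  qed simp
  finally show ?thesis
    unfolding mean_energy_renewal[OF t]
    by (intro add_mono heat_flow_energy_lower[OF L t init])
qed

lemma mean_energy_upper:
  assumes t: "t > 0"
  shows "mean_energy t \<le> (\<integral>\<^sup>+x\<in>{0<..<L}. ennreal ((heat_flow L u\<^sub>0 t x)\<^sup>2) \<partial>lborel) +
    (\<integral>\<^sup>+s\<in>{..<t}. (ennreal (lam\<^sup>2 * L\<^sub>\<sigma>\<^sup>2) * heat_trace_bound L (t - s)) * mean_energy s \<partial>lborel)"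
proof -
  have "ennreal (lam\<^sup>2) *
      (\<integral>\<^sup>+s\<in>{..<t}. (\<integral>\<^sup>+y. heat_kernel_energy L (t - s) y * second_moment \<sigma> (s, y) \<partial>lborel) \<partial>lborel)
    \<le> ennreal (lam\<^sup>2) * (\<integral>\<^sup>+s. ennreal (L\<^sub>\<sigma>\<^sup>2) * (heat_trace_bound L (t - s) * mean_energy s * indicator {..<t} s) \<partial>lborel)"
  proof (intro mult_left_mono nn_integral_mono)
    fix s :: real
    show "(\<integral>\<^sup>+y. heat_kernel_energy L (t - s) y * second_moment \<sigma> (s, y) \<partial>lborel) * indicator {..<t} s \<le>
      ennreal (L\<^sub>\<sigma>\<^sup>2) * (heat_trace_bound L (t - s) * mean_energy s * indicator {..<t} s)"
    proof (cases "s < t")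
      case True
      have "(\<integral>\<^sup>+y. heat_kernel_energy L (t - s) y * second_moment \<sigma> (s, y) \<partial>lborel) \<le>
          (\<integral>\<^sup>+y. heat_trace_bound L (t - s) * (ennreal (L\<^sub>\<sigma>\<^sup>2) * second_moment (\<lambda>x. x) (s, y)) \<partial>lborel)"
        using True L by (intro nn_integral_mono mult_mono heat_kernel_energy_upper second_moment_\<sigma>) auto
      also have "\<dots> = heat_trace_bound L (t - s) * (ennreal (L\<^sub>\<sigma>\<^sup>2) * mean_energy s)"
        unfolding mean_energy_def by (simp add: nn_integral_cmult)
      finally show ?thesis using True by (simp add: mult_ac)
    qed simp
  qed simp
  also have "\<dots> = (\<integral>\<^sup>+s\<in>{..<t}. (ennreal (lam\<^sup>2 * L\<^sub>\<sigma>\<^sup>2) * heat_trace_bound L (t - s)) * mean_energy s \<partial>lborel)"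
    by (subst nn_integral_cmult[symmetric], measurable) (simp add: ennreal_mult mult_ac)
  finally show ?thesis
    unfolding mean_energy_renewal[OF t] by (intro add_left_mono)
qed

lemma mean_energy_locally_bounded: "\<exists>C\<ge>0. \<forall>t\<in>{0<..T}. mean_energy t \<le> ennreal C"
proof (cases "T > 0")
  case True
  then obtain C where C: "\<And>t x. t \<in> {0..T} \<Longrightarrow> x \<in> {0<..<L} \<Longrightarrow> (\<integral>\<^sup>+\<omega>. ennreal ((u t x \<omega>)\<^sup>2) \<partial>M) \<le> ennreal C"
    using mild unfolding mild_solution_def by (meson less_imp_le)
  have "mean_energy t \<le> ennreal (\<bar>C\<bar> * L)" if t: "t \<in> {0<..T}" for t
  proof -
    have "mean_energy t \<le> (\<integral>\<^sup>+y. ennreal \<bar>C\<bar> * indicator {0<..<L} y \<partial>lborel)"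
      unfolding mean_energy_def
    proof (rule nn_integral_mono)
      fix y :: real
      show "second_moment (\<lambda>x. x) (t, y) \<le> ennreal \<bar>C\<bar> * indicator {0<..<L} y"
      proof (cases "y \<in> {0<..<L}")
        case True
        then have "second_moment (\<lambda>x. x) (t, y) = (\<integral>\<^sup>+\<omega>. ennreal ((u t y \<omega>)\<^sup>2) \<partial>M)"
          using t by (simp add: second_moment_def noise_domain_def)
        also have "\<dots> \<le> ennreal C" using C True t by auto
        also have "\<dots> \<le> ennreal \<bar>C\<bar>" by (intro ennreal_leI) simp
        finally show ?thesis using True by simp
      next
        case False
        then have "(t, y) \<notin> D" by (auto simp: noise_domain_def)
        then show ?thesis by (simp add: second_moment_outside)
      qed
    qed
    also have "\<dots> = ennreal (\<bar>C\<bar> * L)"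
      using L by (simp add: nn_integral_cmult_indicator ennreal_mult)
    finally show ?thesis .
  qed
  then show ?thesis using L by (intro exI[of _ "\<bar>C\<bar> * L"]) auto
qed (auto intro: exI[of _ 0])

lemma mean_energy_exponential_lower:
  assumes "t > 0"
  shows "ennreal ((LINT y|lebesgue_on {0..L}. u\<^sub>0 y)\<^sup>2 / L * 2 powr (lam\<^sup>2 * l\<^sub>\<sigma>\<^sup>2 / L * t / 2 - 1)) \<le> mean_energy t"
  using L l lam init_pos assms
  by (intro volterra_exponential_lower mean_energy_lower) auto

text \<open>
  For times up to \<open>1\<close> the contribution of the initial datum is bounded by the energy itself, because
  the stochastic part of the renewal equation is non-negative; this uses the local moment bound of
  the solution.  For later times the kernel is bounded.  The rate \<open>\<beta>\<close> makes the Laplace transform of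
  the renewal kernel equal to at most \<open>1 / 2\<close>.
\<close>

lemma mean_energy_exponential_upper:
  obtains A \<beta> where "A > 0" "\<beta> > 0" "\<And>t. t > 0 \<Longrightarrow> mean_energy t \<le> ennreal (A * exp (\<beta> * t))"
proof -
  let ?H = "\<lambda>t. \<integral>\<^sup>+x\<in>{0<..<L}. ennreal ((heat_flow L u\<^sub>0 t x)\<^sup>2) \<partial>lborel"
  let ?c = "lam\<^sup>2 * L\<^sub>\<sigma>\<^sup>2"
  have c: "?c > 0" using lam u_growth by simp
  obtain B where B: "\<And>t x. t \<ge> 1 \<Longrightarrow> \<bar>heat_flow L u\<^sub>0 t x\<bar> \<le> B"
    using heat_flow_bounded_after[OF L _ init, of 1] by auto
  obtain C where C: "C \<ge> 0" "\<And>t. t \<in> {0<..1} \<Longrightarrow> mean_energy t \<le> ennreal C"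
    using mean_energy_locally_bounded[of 1] by blast
  define A where "A = 1 + C + B\<^sup>2 * L"
  have A: "A > 0" using C L by (simp add: A_def add_pos_nonneg)
  have H: "?H t \<le> ennreal A" if t: "t > 0" for t
  proof (cases "t \<ge> 1")
    case True
    have "?H t \<le> (\<integral>\<^sup>+x. ennreal (B\<^sup>2) * indicator {0<..<L} x \<partial>lborel)"
    proof (intro nn_integral_mono mult_right_mono ennreal_leI)
      show "(heat_flow L u\<^sub>0 t x)\<^sup>2 \<le> B\<^sup>2" for x
        using B[OF True, of x] by (metis abs_ge_zero power2_abs power_mono)
    qed simp
    also have "\<dots> = ennreal (B\<^sup>2 * L)"
      using L by (simp add: nn_integral_cmult_indicator ennreal_mult)
    also have "\<dots> \<le> ennreal A" using C by (intro ennreal_leI) (simp add: A_def)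
    finally show ?thesis .
  next
    case False
    have "?H t \<le> mean_energy t"
      unfolding mean_energy_renewal[OF t] by simp
    also have "\<dots> \<le> ennreal C" using C False t by auto
    also have "\<dots> \<le> ennreal A" using L by (intro ennreal_leI) (simp add: A_def)
    finally show ?thesis .
  qed
  have "1 / (2 * ?c) > 0" using c by simp
  from heat_trace_bound_laplace[OF L this] obtain \<beta> where \<beta>: "\<beta> > 0"
    "(\<integral>\<^sup>+t\<in>{0<..}. ennreal (exp (- \<beta> * t)) * heat_trace_bound L t \<partial>lborel) \<le> ennreal (1 / (2 * ?c))"
    by blast
  have k: "(\<integral>\<^sup>+r\<in>{0<..}. ennreal (exp (- \<beta> * r)) * (ennreal ?c * heat_trace_bound L r) \<partial>lborel) \<le> ennreal (1 / 2)"
  proof -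
    have "(\<integral>\<^sup>+r\<in>{0<..}. ennreal (exp (- \<beta> * r)) * (ennreal ?c * heat_trace_bound L r) \<partial>lborel) =
        ennreal ?c * (\<integral>\<^sup>+r\<in>{0<..}. ennreal (exp (- \<beta> * r)) * heat_trace_bound L r \<partial>lborel)"
      by (subst nn_integral_cmult[symmetric], measurable) (simp add: mult_ac)
    also have "\<dots> \<le> ennreal ?c * ennreal (1 / (2 * ?c))"
      by (intro mult_left_mono \<beta>) simp
    also have "\<dots> = ennreal (1 / 2)"
      using c by (subst ennreal_mult[symmetric]) auto
    finally show ?thesis .
  qed
  have "mean_energy t \<le> ennreal (2 * A * exp (\<beta> * t))" if t: "t > 0" for t
  proof (rule volterra_exponential_upper[OF mean_energy_measurable _ _ \<beta>(1) k _ mean_energy_nonpos _ t])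
    show "0 \<le> A" using A by simp
    show "mean_energy t \<le> ennreal A + (\<integral>\<^sup>+s\<in>{..<t}. (ennreal ?c * heat_trace_bound L (t - s)) * mean_energy s \<partial>lborel)"
      if "t > 0" for t
      using mean_energy_upper[OF that] H[OF that] by (meson add_right_mono order_trans)
    show "\<exists>C. \<forall>t\<in>{0<..T}. mean_energy t \<le> ennreal C" for T
      using mean_energy_locally_bounded by blast
  qed measurable
  then show ?thesis using A \<beta>(1) by (intro that[of "2 * A" \<beta>]) auto
qed

text \<open>
  The Bochner integrals in the definition of the energy take the value \<open>0\<close> on functions that are not
  integrable, so the finiteness of \<open>mean_energy t\<close> is essential here.
\<close>

lemma energy_eq_mean_energy:
  assumes t: "t > 0"
  shows "energy M L u t = sqrt (enn2real (mean_energy t))"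
proof -
  let ?q = "\<lambda>\<omega> y. indicator {0<..<L} y * (u t y \<omega>)\<^sup>2"
  interpret P: pair_sigma_finite lborel M by unfold_locales
  have m: "(\<lambda>w. u t (fst w) (snd w) * indicator D (t, fst w)) \<in> borel_measurable (borel \<Otimes>\<^sub>M M)"
    using u_comp_measurable[of "\<lambda>w. (t, fst w)" "borel \<Otimes>\<^sub>M M" snd] by (simp add: borel_prod[symmetric])
  have e: "(u t y \<omega> * indicator D (t, y))\<^sup>2 = ?q \<omega> y" for y \<omega>
    using t by (auto simp: noise_domain_def indicator_def)
  have qm: "(\<lambda>(y, \<omega>). ?q \<omega> y) \<in> borel_measurable (lborel \<Otimes>\<^sub>M M)"
    using borel_measurable_power[OF m, of 2]
    by (simp add: e case_prod_beta measurable_cong_sets[OF sets_pair_measure_cong[OF sets_lborel refl] refl])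
  define N where "N \<omega> = (\<integral>\<^sup>+y. ennreal (?q \<omega> y) \<partial>lborel)" for \<omega>
  have Nm [measurable]: "N \<in> borel_measurable M"
    unfolding N_def[abs_def] using qm by measurable
  have "mean_energy t = (\<integral>\<^sup>+y. \<integral>\<^sup>+\<omega>. ennreal (?q \<omega> y) \<partial>M \<partial>lborel)"
    unfolding mean_energy_def second_moment_def by (simp add: e)
  also have "\<dots> = (\<integral>\<^sup>+\<omega>. N \<omega> \<partial>M)"
    unfolding N_def using qm by (intro P.Fubini'[symmetric]) (simp add: case_prod_beta)
  finally have me: "mean_energy t = (\<integral>\<^sup>+\<omega>. N \<omega> \<partial>M)" .
  have "\<exists>C. mean_energy t \<le> ennreal C"
    using mean_energy_locally_bounded[of t] t by auto
  then obtain C where "mean_energy t \<le> ennreal C" ..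
  then have "(\<integral>\<^sup>+\<omega>. N \<omega> \<partial>M) \<noteq> \<infinity>"
    unfolding me[symmetric] by (auto simp: top_unique)
  then have fin: "AE \<omega> in M. N \<omega> \<noteq> \<infinity>"
    by (intro nn_integral_PInf_AE) auto
  have norm: "(L2_interval_norm L (\<lambda>x. u t x \<omega>))\<^sup>2 = enn2real (N \<omega>)" if \<omega>: "\<omega> \<in> space M" for \<omega>
  proof -
    have "(LINT x:{0<..<L}|lborel. (u t x \<omega>)\<^sup>2) = enn2real (N \<omega>)"
      unfolding set_lebesgue_integral_def N_def real_scaleR_def
      using measurable_compose[OF measurable_Pair2'[OF \<omega>] qm]
      by (intro integral_eq_nn_integral) auto
    then show ?thesis by (simp add: L2_interval_norm_def)
  qed
  have "(LINT \<omega>|M. (L2_interval_norm L (\<lambda>x. u t x \<omega>))\<^sup>2) = (LINT \<omega>|M. enn2real (N \<omega>))"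
    by (intro Bochner_Integration.integral_cong norm refl)
  also have "\<dots> = enn2real (\<integral>\<^sup>+\<omega>. ennreal (enn2real (N \<omega>)) \<partial>M)"
    by (intro integral_eq_nn_integral) auto
  also have "(\<integral>\<^sup>+\<omega>. ennreal (enn2real (N \<omega>)) \<partial>M) = mean_energy t"
    unfolding me using fin by (intro nn_integral_cong_AE) (auto elim!: eventually_mono simp: less_top)
  finally show ?thesis by (simp add: energy_def)
qed

end

theorem corollary1p6:
  fixes M :: "'a measure"
    and W :: "(real \<times> real) set \<Rightarrow> 'a \<Rightarrow> real"
    and F :: "real \<Rightarrow> 'a measure"
    and \<sigma> u\<^sub>0 :: "real \<Rightarrow> real"
    and L l\<^sub>\<sigma> L\<^sub>\<sigma> K :: real
  assumes "L > 0"
    and "prob_space M"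
    and "white_noise M L W"
    and "noise_filtration M L W F"
    and "K-lipschitz_on UNIV \<sigma>"
    and "l\<^sub>\<sigma> > 0" and "L\<^sub>\<sigma> > 0"
    and "\<And>x. l\<^sub>\<sigma> * \<bar>x\<bar> \<le> \<bar>\<sigma> x\<bar> \<and> \<bar>\<sigma> x\<bar> \<le> L\<^sub>\<sigma> * \<bar>x\<bar>"
    and "u\<^sub>0 \<in> borel_measurable (lebesgue_on {0..L})"
    and "\<And>x. x \<in> {0..L} \<Longrightarrow> 0 \<le> u\<^sub>0 x"
    and "bounded (u\<^sub>0 ` {0..L})"
    and "0 < emeasure lebesgue {x \<in> {0..L}. 0 < u\<^sub>0 x}"
  shows "\<forall>lam>0. \<forall>u. mild_solution M L W F \<sigma> u\<^sub>0 lam u \<longrightarrow>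
           0 < Liminf at_top (\<lambda>t. ereal (1 / t * ln (energy M L u t))) \<and>
           Liminf at_top (\<lambda>t. ereal (1 / t * ln (energy M L u t))) < \<infinity>"
proof (intro allI impI)
  fix lam :: real and u
  assume lam: "lam > 0" and mild: "mild_solution M L W F \<sigma> u\<^sub>0 lam u"
  interpret prob_space M by fact
  have mass: "0 < (LINT y|lebesgue_on {0..L}. u\<^sub>0 y)"
    by (rule integral_pos_of_support) fact+
  interpret stochastic_heat_solution M L W F \<sigma> u\<^sub>0 l\<^sub>\<sigma> L\<^sub>\<sigma> K lam u
    by unfold_locales fact+
  let ?f = "\<lambda>t. 1 / t * ln (energy M L u t)"
  define \<kappa> where "\<kappa> = lam\<^sup>2 * l\<^sub>\<sigma>\<^sup>2 / L"
  define c where "c = (LINT y|lebesgue_on {0..L}. u\<^sub>0 y)\<^sup>2 / L"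
  have \<kappa>: "\<kappa> > 0" and c: "c > 0"
    using L l lam init_pos by (auto simp: \<kappa>_def c_def)
  obtain A \<beta> where A: "A > 0" "\<beta> > 0" and up: "\<And>t. t > 0 \<Longrightarrow> mean_energy t \<le> ennreal (A * exp (\<beta> * t))"
    using mean_energy_exponential_upper by blast
  have bounds: "ln c / (2 * t) + (\<kappa> / 4 - 1 / (2 * t)) * ln 2 \<le> ?f t"
      "?f t \<le> ln A / (2 * t) + \<beta> / 2" if t: "t > 0" for t
  proof -
    define e where "e = enn2real (mean_energy t)"
    have fin: "mean_energy t < top"
      using up[OF t] by (rule le_less_trans) simp
    then have me: "mean_energy t = ennreal e" by (simp add: e_def)
    have lo: "c * 2 powr (\<kappa> * t / 2 - 1) \<le> e"
      using mean_energy_exponential_lower[OF t] unfolding \<kappa>_def[symmetric] c_def[symmetric] me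
      by (subst (asm) ennreal_le_iff) (simp_all add: e_def)
    have hi: "e \<le> A * exp (\<beta> * t)"
      using up[OF t] A unfolding me by (subst (asm) ennreal_le_iff) simp_all
    have e: "e > 0"
      by (rule less_le_trans[OF _ lo]) (use c in simp)
    have f: "?f t = ln e / (2 * t)"
      using e t by (simp add: energy_eq_mean_energy[OF t] e_def[symmetric] ln_sqrt)
    have "ln c + (\<kappa> * t / 2 - 1) * ln 2 = ln (c * 2 powr (\<kappa> * t / 2 - 1))"
      using c by (simp add: ln_mult ln_powr)
    also have "\<dots> \<le> ln e"
      using lo c e by (subst ln_le_cancel_iff) auto
    finally have "(ln c + (\<kappa> * t / 2 - 1) * ln 2) / (2 * t) \<le> ln e / (2 * t)"
      using t by (intro divide_right_mono) auto
    moreover have "(ln c + (\<kappa> * t / 2 - 1) * ln 2) / (2 * t) = ln c / (2 * t) + (\<kappa> / 4 - 1 / (2 * t)) * ln 2"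
      using t by (simp add: field_simps)
    ultimately show "ln c / (2 * t) + (\<kappa> / 4 - 1 / (2 * t)) * ln 2 \<le> ?f t"
      unfolding f by simp
    have "ln e \<le> ln (A * exp (\<beta> * t))"
      using hi A e by (subst ln_le_cancel_iff) auto
    also have "\<dots> = ln A + \<beta> * t" using A by (simp add: ln_mult)
    finally have "ln e / (2 * t) \<le> (ln A + \<beta> * t) / (2 * t)"
      using t by (intro divide_right_mono) auto
    also have "\<dots> = ln A / (2 * t) + \<beta> / 2"
      using t by (simp add: field_simps)
    finally show "?f t \<le> ln A / (2 * t) + \<beta> / 2" unfolding f .
  qed
  have lim: "((\<lambda>t. b / (2 * t)) \<longlongrightarrow> 0) at_top" for b :: real
    by (intro real_tendsto_divide_at_top[OF tendsto_const]
      filterlim_tendsto_pos_mult_at_top[OF tendsto_const _ filterlim_ident]) simp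
  have "((\<lambda>t. ln c / (2 * t) + (\<kappa> / 4 - 1 / (2 * t)) * ln 2) \<longlongrightarrow> 0 + (\<kappa> / 4 - 0) * ln 2) at_top"
    by (intro tendsto_intros lim)
  \<comment> \<open>half of the limit rate \<open>(\<kappa> / 4) ln 2\<close> leaves room for the terms of order \<open>1 / t\<close>\<close>
  then have "\<forall>\<^sub>F t in at_top. \<kappa> / 8 * ln 2 < ln c / (2 * t) + (\<kappa> / 4 - 1 / (2 * t)) * ln 2"
    by (rule order_tendstoD) (use \<kappa> in simp)
  then have "\<forall>\<^sub>F t in at_top. ereal (\<kappa> / 8 * ln 2) \<le> ereal (?f t)"
    using eventually_gt_at_top[of 0]
  proof eventually_elim
    case (elim t)
    then have "\<kappa> / 8 * ln 2 \<le> ?f t" using bounds(1)[of t] by linarith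
    then show ?case by (simp only: ereal_less_eq)
  qed
  then have "ereal (\<kappa> / 8 * ln 2) \<le> Liminf at_top (\<lambda>t. ereal (?f t))"
    by (rule Liminf_bounded)
  moreover have "0 < ereal (\<kappa> / 8 * ln 2)" using \<kappa> by simp
  ultimately have pos: "0 < Liminf at_top (\<lambda>t. ereal (?f t))" by (rule less_le_trans[rotated])
  have "((\<lambda>t. ln A / (2 * t) + \<beta> / 2) \<longlongrightarrow> 0 + \<beta> / 2) at_top"
    by (intro tendsto_intros lim)
  then have "\<forall>\<^sub>F t in at_top. ln A / (2 * t) + \<beta> / 2 < \<beta>"
    by (rule order_tendstoD) (use A in simp)
  then have "\<forall>\<^sub>F t in at_top. ereal (?f t) \<le> ereal \<beta>"
    using eventually_gt_at_top[of 0]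
  proof eventually_elim
    case (elim t)
    then have "?f t \<le> \<beta>" using bounds(2)[of t] by linarith
    then show ?case by (simp only: ereal_less_eq)
  qed
  then have "Limsup at_top (\<lambda>t. ereal (?f t)) \<le> ereal \<beta>"
    by (rule Limsup_bounded)
  then have "Liminf at_top (\<lambda>t. ereal (?f t)) \<le> ereal \<beta>"
    using Liminf_le_Limsup[of "at_top :: real filter" "\<lambda>t. ereal (?f t)"] by simp
  then have "Liminf at_top (\<lambda>t. ereal (?f t)) < \<infinity>"
    by (rule le_less_trans) simp
  with pos show "0 < Liminf at_top (\<lambda>t. ereal (?f t)) \<and> Liminf at_top (\<lambda>t. ereal (?f t)) < \<infinity>" ..
qed

end
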